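(* Let $\mathbb F$ be a free group of finite rank at least $3$ and let $S$ be a set of lines in $\mathbb F$. If $S$ is filling in the sense of free factor supports and there does not exist any proper free factor of any finite index subgroup of $\mathbb F$ that carries a line in $S$, then $S$ is minimally filling in $\mathbb F$. The converse also holds: if $S$ is minimally filling in $\mathbb F$, then $S$ is filling in the sense of free factor supports and there does not exist any proper free factor of any finite index subgroup of $\mathbb F$ that carries a line in $S$.
   Context: Lines: $\widetilde{\mathcal B}=(\partial\mathbb F\times\partial\mathbb F-\text{diagonal})/\mathbb Z_2$ ($\mathbb Z_2$ interchanging factors), $\mathcal B=\widetilde{\mathcal B}/\mathbb F$; elements of $\mathcal B$ are lines, a lift of a line is a preimage in $\widetilde{\mathcal B}$, whose two elements are its endpoints. A finitely generated subgroup $K<\mathbb F$ carries a line if some lift of the line has both endpoints in $\partial K\subset\partial\mathbb F$. $S$ is minimally filling if there does not exist any finitely generated infinite index subgroup of $\mathbb F$ that carries a line of $S$. A free factor system is a finite collection $\{[K_1],\dots,[K_p]\}$ of conjugacy classes of subgroups for which there is a free factorization $\mathbb F=K_1*\dots*K_p*B$ ($B$ possibly trivial); it carries a line if some $K_i$ does. The free factor support of a set of lines is the smallest free factor system carrying all of them (the meet of all free factor systems that carry the set); the set is filling (in the sense of free factor supports) if its free factor support is $\{[\mathbb F]\}$.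
   Formalization: The converse is stated for nonempty S only: the empty set of lines is vacuously minimally filling, but its free factor support is not {[F]}, so the converse fails for it. *)

theory Defs
  imports "HOL-Algebra.Generated_Groups"
begin

section \<open>Free groups\<close>

text \<open>A letter \<open>(x, True)\<close> stands for \<open>x\<close> and \<open>(x, False)\<close> for its inverse.\<close>

type_synonym 'a letter = "'a \<times> bool"

definition cancelling :: "'a letter \<Rightarrow> 'a letter \<Rightarrow> bool" where
  "cancelling p q \<longleftrightarrow> fst p = fst q \<and> snd p \<noteq> snd q"

definition reduced_words :: "'a set \<Rightarrow> 'a letter list set" where
  "reduced_words X = {w. set w \<subseteq> X \<times> UNIV \<and> successively (\<lambda>p q. \<not> cancelling p q) w}"

definition letter_value :: "('a, 'm) monoid_scheme \<Rightarrow> 'a letter \<Rightarrow> 'a" where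
  "letter_value G p = (if snd p then fst p else inv\<^bsub>G\<^esub> (fst p))"

definition word_value :: "('a, 'm) monoid_scheme \<Rightarrow> 'a letter list \<Rightarrow> 'a" where
  "word_value G w = foldr (\<lambda>p a. letter_value G p \<otimes>\<^bsub>G\<^esub> a) w \<one>\<^bsub>G\<^esub>"

text \<open>\<open>X\<close> is a free basis iff evaluation of words is a bijection from the free group on \<open>X\<close>
  (realised by the reduced words) onto \<open>G\<close>.\<close>

definition free_basis :: "('a, 'm) monoid_scheme \<Rightarrow> 'a set \<Rightarrow> bool" where
  "free_basis G X \<longleftrightarrow> X \<subseteq> carrier G \<and> bij_betw (word_value G) (reduced_words X) (carrier G)"

definition normal_form :: "('a, 'm) monoid_scheme \<Rightarrow> 'a set \<Rightarrow> 'a \<Rightarrow> 'a letter list" where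
  "normal_form G X = the_inv_into (reduced_words X) (word_value G)"

section \<open>The boundary\<close>

text \<open>The boundary of a free group with basis \<open>X\<close>, as the set of infinite reduced words,
  i.e. the rays from the identity in the Cayley tree.\<close>

definition boundary :: "'a set \<Rightarrow> (nat \<Rightarrow> 'a letter) set" where
  "boundary X = {\<xi>. range \<xi> \<subseteq> X \<times> UNIV \<and> (\<forall>n. \<not> cancelling (\<xi> n) (\<xi> (Suc n)))}"

definition prefix_word :: "nat \<Rightarrow> (nat \<Rightarrow> 'a letter) \<Rightarrow> 'a letter list" where
  "prefix_word n \<xi> = map \<xi> [0..<n]"

text \<open>Convergence of a sequence of group elements to a boundary point, in the compactification
  of \<open>G\<close> by its boundary.\<close>

definition converges_to_end ::
    "('a, 'm) monoid_scheme \<Rightarrow> 'a set \<Rightarrow> (nat \<Rightarrow> 'a) \<Rightarrow> (nat \<Rightarrow> 'a letter) \<Rightarrow> bool" where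
  "converges_to_end G X a \<xi> \<longleftrightarrow>
     (\<forall>m. \<exists>N. \<forall>n\<ge>N. take m (normal_form G X (a n)) = prefix_word m \<xi>)"

text \<open>The continuous extension of left multiplication by \<open>g\<close> to the boundary.\<close>

definition boundary_act ::
    "('a, 'm) monoid_scheme \<Rightarrow> 'a set \<Rightarrow> 'a \<Rightarrow> (nat \<Rightarrow> 'a letter) \<Rightarrow> (nat \<Rightarrow> 'a letter)" where
  "boundary_act G X g \<xi> =
     (THE \<eta>. \<eta> \<in> boundary X \<and>
        converges_to_end G X (\<lambda>n. g \<otimes>\<^bsub>G\<^esub> word_value G (prefix_word n \<xi>)) \<eta>)"

text \<open>For a finitely generated subgroup \<open>K\<close> with free basis \<open>Y\<close>, the inclusion of \<open>K\<close> in \<open>G\<close>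
  extends to an embedding of boundaries, sending an infinite reduced word in \<open>Y\<close> to the limit in
  the boundary of \<open>G\<close> of the values of its prefixes. The set below is its image; it does not
  depend on the choice of \<open>Y\<close>.\<close>

definition subgroup_boundary ::
    "('a, 'm) monoid_scheme \<Rightarrow> 'a set \<Rightarrow> 'a set \<Rightarrow> (nat \<Rightarrow> 'a letter) set" where
  "subgroup_boundary G X K =
     {\<xi> \<in> boundary X. \<exists>Y. free_basis (G\<lparr>carrier := K\<rparr>) Y \<and>
        (\<exists>\<eta> \<in> boundary Y. converges_to_end G X (\<lambda>n. word_value G (prefix_word n \<eta>)) \<xi>)}"

section \<open>Lines\<close>

text \<open>A point of the space of lifts is an unordered pair of distinct boundary points; a line is
  an orbit of such pairs, so that its lifts are its elements.\<close>

definition line_lifts :: "'a set \<Rightarrow> (nat \<Rightarrow> 'a letter) set set" where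
  "line_lifts X = {{\<xi>, \<eta>} | \<xi> \<eta>. \<xi> \<in> boundary X \<and> \<eta> \<in> boundary X \<and> \<xi> \<noteq> \<eta>}"

definition same_line ::
    "('a, 'm) monoid_scheme \<Rightarrow> 'a set
      \<Rightarrow> ((nat \<Rightarrow> 'a letter) set \<times> (nat \<Rightarrow> 'a letter) set) set" where
  "same_line G X = {(L, M). L \<in> line_lifts X \<and> M \<in> line_lifts X \<and>
     (\<exists>g \<in> carrier G. M = boundary_act G X g ` L)}"

definition lines ::
    "('a, 'm) monoid_scheme \<Rightarrow> 'a set \<Rightarrow> (nat \<Rightarrow> 'a letter) set set set" where
  "lines G X = line_lifts X // same_line G X"

definition carries ::
    "('a, 'm) monoid_scheme \<Rightarrow> 'a set \<Rightarrow> 'a set \<Rightarrow> (nat \<Rightarrow> 'a letter) set set \<Rightarrow> bool" where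
  "carries G X K l \<longleftrightarrow> (\<exists>L \<in> l. L \<subseteq> subgroup_boundary G X K)"

definition finitely_generated :: "('a, 'm) monoid_scheme \<Rightarrow> 'a set \<Rightarrow> bool" where
  "finitely_generated G K \<longleftrightarrow> (\<exists>A. finite A \<and> A \<subseteq> K \<and> generate G A = K)"

definition finite_index :: "('a, 'm) monoid_scheme \<Rightarrow> 'a set \<Rightarrow> bool" where
  "finite_index G H \<longleftrightarrow> finite (rcosets\<^bsub>G\<^esub> H)"

definition minimally_filling ::
    "('a, 'm) monoid_scheme \<Rightarrow> 'a set \<Rightarrow> (nat \<Rightarrow> 'a letter) set set set \<Rightarrow> bool" where
  "minimally_filling G X S \<longleftrightarrow>
     \<not> (\<exists>K. subgroup K G \<and> finitely_generated G K \<and> \<not> finite_index G K \<and>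
            (\<exists>l \<in> S. carries G X K l))"

section \<open>Free factors\<close>

text \<open>Elements of the external free product of \<open>Ks ! 0, Ks ! 1, \<dots>\<close> in normal form: a syllable
  \<open>(i, g)\<close> is a nontrivial \<open>g\<close> in the factor \<open>Ks ! i\<close>.\<close>

definition alternating_words :: "('a, 'm) monoid_scheme \<Rightarrow> 'a set list \<Rightarrow> (nat \<times> 'a) list set" where
  "alternating_words G Ks =
     {w. (\<forall>(i, g) \<in> set w. i < length Ks \<and> g \<in> Ks ! i \<and> g \<noteq> \<one>\<^bsub>G\<^esub>) \<and>
         successively (\<lambda>p q. fst p \<noteq> fst q) w}"

definition free_factorization :: "('a, 'm) monoid_scheme \<Rightarrow> 'a set list \<Rightarrow> bool" where
  "free_factorization G Ks \<longleftrightarrow>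
     (\<forall>K \<in> set Ks. subgroup K G) \<and>
     bij_betw (\<lambda>w. foldr (\<lambda>p a. snd p \<otimes>\<^bsub>G\<^esub> a) w \<one>\<^bsub>G\<^esub>) (alternating_words G Ks) (carrier G)"

definition proper_free_factor :: "('a, 'm) monoid_scheme \<Rightarrow> 'a set \<Rightarrow> bool" where
  "proper_free_factor G A \<longleftrightarrow> A \<noteq> carrier G \<and> (\<exists>B. free_factorization G [A, B])"

definition subgroup_conj_class :: "('a, 'm) monoid_scheme \<Rightarrow> 'a set \<Rightarrow> 'a set set" where
  "subgroup_conj_class G K = {(\<lambda>x. g \<otimes>\<^bsub>G\<^esub> x \<otimes>\<^bsub>G\<^esub> inv\<^bsub>G\<^esub> g) ` K | g. g \<in> carrier G}"

text \<open>The listed factors are nontrivial, as usual for free factor systems: this makes the relation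
  below antisymmetric. The cofactor \<open>B\<close> may be trivial.\<close>

definition free_factor_system :: "('a, 'm) monoid_scheme \<Rightarrow> 'a set set set \<Rightarrow> bool" where
  "free_factor_system G \<F> \<longleftrightarrow>
     (\<exists>Ks B. free_factorization G (Ks @ [B]) \<and> (\<forall>K \<in> set Ks. K \<noteq> {\<one>\<^bsub>G\<^esub>}) \<and>
             \<F> = subgroup_conj_class G ` set Ks)"

definition system_le :: "'a set set set \<Rightarrow> 'a set set set \<Rightarrow> bool" where
  "system_le \<F> \<F>' \<longleftrightarrow> (\<forall>c \<in> \<F>. \<exists>c' \<in> \<F>'. \<exists>K \<in> c. \<exists>K' \<in> c'. K \<subseteq> K')"

definition system_carries ::
    "('a, 'm) monoid_scheme \<Rightarrow> 'a set \<Rightarrow> 'a set set set \<Rightarrow> (nat \<Rightarrow> 'a letter) set set \<Rightarrow> bool" where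
  "system_carries G X \<F> l \<longleftrightarrow> (\<exists>c \<in> \<F>. \<exists>K \<in> c. carries G X K l)"

definition is_free_factor_support ::
    "('a, 'm) monoid_scheme \<Rightarrow> 'a set \<Rightarrow> (nat \<Rightarrow> 'a letter) set set set \<Rightarrow> 'a set set set \<Rightarrow> bool" where
  "is_free_factor_support G X S \<F> \<longleftrightarrow>
     free_factor_system G \<F> \<and> (\<forall>l \<in> S. system_carries G X \<F> l) \<and>
     (\<forall>\<F>'. free_factor_system G \<F>' \<and> (\<forall>l \<in> S. system_carries G X \<F>' l) \<longrightarrow> system_le \<F> \<F>')"

definition filling ::
    "('a, 'm) monoid_scheme \<Rightarrow> 'a set \<Rightarrow> (nat \<Rightarrow> 'a letter) set set set \<Rightarrow> bool" where
  "filling G X S \<longleftrightarrow> is_free_factor_support G X S {subgroup_conj_class G (carrier G)}"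

end

theory Submission
  imports Defs
begin

text \<open>The theorem compares two ways for a finitely generated subgroup of infinite index to arise.

  On the one hand, Marshall Hall's theorem says that every finitely generated subgroup \<open>K\<close> of a free
  group is a free factor of some subgroup \<open>H\<close> of finite index. If \<open>K\<close> has infinite index, then
  \<open>K \<noteq> H\<close>, so \<open>K\<close> is a proper free factor of \<open>H\<close>. Thus a line carried by such a \<open>K\<close> is carried by a
  proper free factor of a subgroup of finite index.

  On the other hand, a proper free factor \<open>A\<close> of a subgroup \<open>H\<close> of finite index is finitely generated
  (\<open>H\<close> is, by Schreier's lemma, and free factors inherit this) and has infinite index: by
  uniqueness of normal forms in a free product there is an element none of whose positive powers
  lies in \<open>A\<close> (for trivial \<open>A\<close>, a basis element). So a minimally filling set has no line carried by \<open>A\<close>. With \<open>H\<close> the whole group the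
  same argument shows that a free factor system carrying a line of a minimally filling set
  contains the class of the whole group, which is the filling property.

  In all these arguments the notion of carrying a line is used for one and the same subgroup, so
  the boundary enters only through the fact that the whole group carries every line.

  The main work is Marshall Hall's theorem. Following Stallings, the action of the free group on
  finitely many cosets of \<open>K\<close>, partially defined, is completed to an action on a finite set; \<open>H\<close> is
  the stabiliser of the base point. The resulting graph is the union of the edges that come from
  \<open>K\<close> and the added edges, and choosing a maximal tree inside the former splits \<open>H\<close> into \<open>K\<close> and a
  complement. That the product is free is a ping-pong argument on reduced words: what matters is
  the first edge of a reduced path that lies outside the tree.\<close>

section \<open>Cosets and finite index\<close>

lemma (in group) rcos_eq_iff:
  assumes "subgroup K G" "a \<in> carrier G" "b \<in> carrier G"
  shows "K #> a = K #> b \<longleftrightarrow> a \<otimes> inv b \<in> K"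
  using assms
  by (metis group.rcos_self is_group repr_independence subgroup.rcos_module)

text \<open>Among infinitely many powers of \<open>c\<close> two lie in the same coset. The contrapositive is the way
  in which infinite index is detected below.\<close>

lemma (in group) finite_index_imp_power_mem:
  assumes K: "subgroup K G" and fin: "finite_index G K" and c: "c \<in> carrier G"
  shows "\<exists>k>0. c [^] (k::nat) \<in> K"
proof -
  have KG: "K \<subseteq> carrier G" using K by (rule subgroup.subset)
  have "range (\<lambda>n::nat. K #> c [^] n) \<subseteq> rcosets K"
    using c KG by (auto intro: rcosetsI)
  then have "finite (range (\<lambda>n::nat. K #> c [^] n))"
    using fin unfolding finite_index_def by (rule finite_subset)
  then have "\<not> inj (\<lambda>n::nat. K #> c [^] n)"
    using finite_imageD infinite_UNIV_nat by blast
  then obtain i j :: nat where "i \<noteq> j" and eq: "K #> c [^] i = K #> c [^] j"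
    unfolding inj_def by blast
  then obtain m n :: nat where "m < n" and mn: "K #> c [^] n = K #> c [^] m"
    by (metis linorder_neqE_nat)
  then obtain k where k: "n = k + m" "k > 0"
    by (metis add.commute less_imp_add_positive)
  have "c [^] n \<otimes> inv (c [^] m) \<in> K"
    using mn K c by (simp add: rcos_eq_iff)
  also have "c [^] n \<otimes> inv (c [^] m) = c [^] k"
    using c k(1) nat_pow_mult[OF c, of k m] by (metis inv_solve_right nat_pow_closed)
  finally show ?thesis using k by blast
qed

lemma (in group) finite_indexI:
  assumes Q: "finite Q" "Q \<subseteq> carrier G" and K: "subgroup K G"
    and cover: "\<And>g. g \<in> carrier G \<Longrightarrow> \<exists>q\<in>Q. g \<otimes> inv q \<in> K"
  shows "finite_index G K"
proof -
  have "rcosets K \<subseteq> (\<lambda>q. K #> q) ` Q"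
  proof
    fix c assume "c \<in> rcosets K"
    then obtain g where g: "g \<in> carrier G" "c = K #> g" by (auto simp: RCOSETS_def)
    obtain q where "q \<in> Q" "g \<otimes> inv q \<in> K" using cover[OF g(1)] by blast
    then show "c \<in> (\<lambda>q. K #> q) ` Q" using rcos_eq_iff[OF K, of g q] g Q(2) by blast
  qed
  then show ?thesis
    unfolding finite_index_def using Q(1) by (meson finite_imageI finite_subset)
qed

text \<open>Schreier's lemma. Let \<open>T\<close> be a finite set of representatives of the right cosets, enlarged by
  \<open>\<one>\<close>. The elements \<open>t a t'\<inverse>\<close> of \<open>H\<close>, where \<open>a\<close> is \<open>\<one>\<close>, a generator or the inverse of one,
  generate \<open>H\<close>: rewriting an element of \<open>H\<close> letter by letter from the left turns it into a product
  of them followed by some \<open>t \<in> T\<close>. This \<open>t\<close> lies in \<open>H\<close>, so \<open>t = t \<one> \<one>\<inverse>\<close> is itself on the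
  list.\<close>

lemma (in group) finite_index_finitely_generated:
  assumes fg: "finitely_generated G (carrier G)"
    and H: "subgroup H G" and fin: "finite_index G H"
  shows "finitely_generated G H"
proof -
  obtain A where A: "finite A" "A \<subseteq> carrier G" "generate G A = carrier G"
    using fg unfolding finitely_generated_def by blast
  have HG: "H \<subseteq> carrier G" using H by (rule subgroup.subset)
  define r where "r c = (SOME t. t \<in> carrier G \<and> H #> t = c)" for c
  have r: "r c \<in> carrier G \<and> H #> r c = c" if "c \<in> rcosets H" for c
  proof -
    have "\<exists>t. t \<in> carrier G \<and> H #> t = c"
      using that by (auto simp: RCOSETS_def)
    then show ?thesis unfolding r_def by (rule someI_ex)
  qed
  define T where "T = insert \<one> (r ` (rcosets H))"
  have T: "finite T" "T \<subseteq> carrier G"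
    using fin r unfolding T_def finite_index_def by auto
  have rep: "\<exists>t\<in>T. g \<otimes> inv t \<in> H" if "g \<in> carrier G" for g
  proof -
    have c: "H #> g \<in> rcosets H" using HG that by (rule rcosetsI)
    then have "H #> g = H #> r (H #> g)" "r (H #> g) \<in> carrier G" using r by auto
    then have "g \<otimes> inv (r (H #> g)) \<in> H" using rcos_eq_iff[OF H] that by blast
    then show ?thesis unfolding T_def using c by blast
  qed
  define A' where "A' = insert \<one> (A \<union> (\<lambda>a. inv a) ` A)"
  have A': "finite A'" "A' \<subseteq> carrier G" using A unfolding A'_def by auto
  define B where "B = H \<inter> (\<lambda>(t, a, t'). t \<otimes> a \<otimes> inv t') ` (T \<times> A' \<times> T)"
  have B: "finite B" "B \<subseteq> H" using T A' unfolding B_def by auto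
  have BG: "B \<subseteq> carrier G" using B HG by blast
  have gB: "subgroup (generate G B) G" using BG by (rule generate_is_subgroup)
  have rewr: "\<exists>s\<in>generate G B. \<exists>t'\<in>T. t \<otimes> a = s \<otimes> t'" if t: "t \<in> T" and a: "a \<in> A'" for t a
  proof -
    have c: "t \<in> carrier G" "a \<in> carrier G" using t a T A' by auto
    obtain t' where t': "t' \<in> T" "t \<otimes> a \<otimes> inv t' \<in> H"
      using rep[of "t \<otimes> a"] c by auto
    then have "t \<otimes> a \<otimes> inv t' \<in> B" unfolding B_def using t a by force
    then have "t \<otimes> a \<otimes> inv t' \<in> generate G B" by (rule generate.incl)
    moreover have "t' \<in> carrier G" using t' T by auto
    then have "t \<otimes> a = (t \<otimes> a \<otimes> inv t') \<otimes> t'" using c by (simp add: m_assoc)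
    ultimately show ?thesis using t' by blast
  qed
  have key: "\<forall>t\<in>T. \<exists>s\<in>generate G B. \<exists>t'\<in>T. t \<otimes> g = s \<otimes> t'" if "g \<in> generate G A" for g
    using that
  proof (induction g rule: generate.induct)
    case one then show ?case using rewr by (auto simp: A'_def)
  next
    case (incl h) then show ?case using rewr by (auto simp: A'_def)
  next
    case (inv h) then show ?case using rewr by (auto simp: A'_def)
  next
    case (eng h1 h2)
    show ?case
    proof
      fix t assume t: "t \<in> T"
      obtain s t' where 1: "s \<in> generate G B" "t' \<in> T" "t \<otimes> h1 = s \<otimes> t'"
        using eng.IH(1) t by blast
      obtain s' t'' where 2: "s' \<in> generate G B" "t'' \<in> T" "t' \<otimes> h2 = s' \<otimes> t''"
        using eng.IH(2) 1 by blast
      have c: "h1 \<in> carrier G" "h2 \<in> carrier G" "t \<in> carrier G" "s \<in> carrier G"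
        "s' \<in> carrier G" "t' \<in> carrier G" "t'' \<in> carrier G"
        using eng.hyps A(2) T 1 2 t generate_in_carrier BG by auto
      have "t \<otimes> (h1 \<otimes> h2) = t \<otimes> h1 \<otimes> h2" using c by (simp add: m_assoc)
      also have "\<dots> = s \<otimes> (t' \<otimes> h2)" using c 1(3) by (simp add: m_assoc)
      also have "\<dots> = (s \<otimes> s') \<otimes> t''" using c 2(3) by (simp add: m_assoc)
      finally show "\<exists>s\<in>generate G B. \<exists>t'\<in>T. t \<otimes> (h1 \<otimes> h2) = s \<otimes> t'"
        using 1 2 generate.eng by metis
    qed
  qed
  have "H \<subseteq> generate G B"
  proof
    fix h assume h: "h \<in> H"
    then have hc: "h \<in> carrier G" using HG by blast
    have "\<one> \<in> T" by (simp add: T_def)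
    then obtain s t where st: "s \<in> generate G B" "t \<in> T" "\<one> \<otimes> h = s \<otimes> t"
      using key hc A(3) by blast
    have c: "s \<in> H" "t \<in> carrier G"
      using st T generate_subgroup_incl[OF B(2) H] by auto
    have sc: "s \<in> carrier G" using c HG by blast
    have "t = inv s \<otimes> h" using st(3) hc c(2) sc by (simp add: inv_solve_left)
    then have "t \<in> H" using h c H by (simp add: subgroup.m_closed subgroup.m_inv_closed)
    moreover have "(\<lambda>(t, a, t'). t \<otimes> a \<otimes> inv t') (t, \<one>, \<one>) = t" using c by simp
    moreover have "(t, \<one>, \<one>) \<in> T \<times> A' \<times> T"
      using st(2) by (auto simp: A'_def T_def)
    ultimately have "t \<in> B" unfolding B_def by (intro IntI) (assumption, rule image_eqI, rule sym)
    then have "s \<otimes> t \<in> generate G B" using st(1) by (blast intro: generate.intros)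
    then show "h \<in> generate G B" using st(3) hc by simp
  qed
  then have "generate G B = H" using generate_subgroup_incl[OF B(2) H] by blast
  then show ?thesis unfolding finitely_generated_def using B by blast
qed

section \<open>Free products\<close>

lemma (in group) alternating_product_closed:
  assumes "\<forall>K\<in>set Ks. subgroup K G" "w \<in> alternating_words G Ks"
  shows "foldr (\<lambda>p a. snd p \<otimes> a) w \<one> \<in> carrier G"
  using assms(2)
proof (induction w)
  case (Cons p w)
  then have "w \<in> alternating_words G Ks" "snd p \<in> Ks ! fst p" "fst p < length Ks"
    by (auto simp: alternating_words_def successively_Cons split: prod.splits)
  moreover from this have "snd p \<in> carrier G"
    using assms(1) nth_mem subgroup.mem_carrier by metis
  ultimately show ?case using Cons.IH by simp
qed simp

text \<open>A new syllable is appended, absorbed by the first one, or cancels it. This step turns products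
  of elements of the factors into normal forms.\<close>

lemma (in group) alternating_prepend:
  assumes sub: "\<forall>K\<in>set Ks. subgroup K G"
    and i: "i < length Ks" and g: "g \<in> Ks ! i" and w: "w \<in> alternating_words G Ks"
  shows "\<exists>w'\<in>alternating_words G Ks.
    foldr (\<lambda>p a. snd p \<otimes> a) w' \<one> = g \<otimes> foldr (\<lambda>p a. snd p \<otimes> a) w \<one>"
proof -
  have Ki: "subgroup (Ks ! i) G" using sub i by simp
  have gc: "g \<in> carrier G" using Ki g by (rule subgroup.mem_carrier)
  note cl = alternating_product_closed[OF sub]
  consider "g = \<one>" | "g \<noteq> \<one>" "w = [] \<or> fst (hd w) \<noteq> i"
    | h u where "g \<noteq> \<one>" "w = (i, h) # u"
    by (cases w; cases "g = \<one>"; cases "fst (hd w) = i") auto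
  then show ?thesis
  proof cases
    case 1 then show ?thesis using w cl[OF w] by (metis l_one)
  next
    case 2
    then have "(i, g) # w \<in> alternating_words G Ks"
      using w i g by (auto simp: alternating_words_def successively_Cons)
    then show ?thesis by force
  next
    case 3
    then have u: "u \<in> alternating_words G Ks" and h: "h \<in> Ks ! i" "u = [] \<or> fst (hd u) \<noteq> i"
      using w by (auto simp: alternating_words_def successively_Cons)
    have hc: "h \<in> carrier G" using Ki h(1) by (rule subgroup.mem_carrier)
    have eq: "g \<otimes> foldr (\<lambda>p a. snd p \<otimes> a) w \<one> = (g \<otimes> h) \<otimes> foldr (\<lambda>p a. snd p \<otimes> a) u \<one>"
      using 3 cl[OF u] gc hc by (simp add: m_assoc)
    show ?thesis
    proof (cases "g \<otimes> h = \<one>")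
      case True
      then show ?thesis using eq u cl[OF u] by (metis l_one)
    next
      case False
      then have "(i, g \<otimes> h) # u \<in> alternating_words G Ks"
        using u h i g Ki by (auto simp: alternating_words_def successively_Cons subgroup.m_closed)
      then show ?thesis using eq by force
    qed
  qed
qed

lemma (in group) alternating_product_exists:
  assumes sub: "\<forall>K\<in>set Ks. subgroup K G" and g: "g \<in> generate G (\<Union>(set Ks))"
  shows "\<exists>w\<in>alternating_words G Ks. foldr (\<lambda>p a. snd p \<otimes> a) w \<one> = g"
proof -
  let ?val = "\<lambda>w. foldr (\<lambda>p a. snd p \<otimes> a) w \<one>"
  have UG: "\<Union>(set Ks) \<subseteq> carrier G" using sub subgroup.subset by blast
  have letter: "\<exists>w'\<in>alternating_words G Ks. ?val w' = h \<otimes> ?val w"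
    if "K \<in> set Ks" "h \<in> K" "w \<in> alternating_words G Ks" for K h w
  proof -
    obtain i where "i < length Ks" "h \<in> Ks ! i" using \<open>K \<in> set Ks\<close> \<open>h \<in> K\<close> by (metis in_set_conv_nth)
    then show ?thesis using alternating_prepend[OF sub _ _ that(3)] by blast
  qed
  have "\<forall>w\<in>alternating_words G Ks. \<exists>w'\<in>alternating_words G Ks. ?val w' = g \<otimes> ?val w"
    using g
  proof (induction g rule: generate.induct)
    case one then show ?case using alternating_product_closed[OF sub] by (metis l_one)
  next
    case (incl h) then show ?case using letter by blast
  next
    case (inv h)
    then obtain K where K: "K \<in> set Ks" "h \<in> K" by blast
    then have "inv h \<in> K" using sub by (simp add: subgroup.m_inv_closed)
    then show ?case using letter[OF K(1)] by blast
  next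
    case (eng h1 h2)
    have "h1 \<in> carrier G" "h2 \<in> carrier G"
      using eng.hyps generate_in_carrier[OF UG] by auto
    then show ?case using eng.IH alternating_product_closed[OF sub] by (metis m_assoc)
  qed
  moreover have "[] \<in> alternating_words G Ks" by (simp add: alternating_words_def)
  moreover have "g \<in> carrier G" using g generate_in_carrier[OF UG] by blast
  ultimately show ?thesis by (metis foldr.simps(1) id_apply r_one)
qed

text \<open>Ping-pong. The value of a nonempty alternating word lies in the set \<open>P i\<close> that belongs to its
  first syllable, so the value determines the index \<open>i\<close>. It also determines the syllable: if
  \<open>g u = h v\<close> with \<open>g \<noteq> h\<close> in the \<open>i\<close>-th factor, then \<open>(h\<inverse> g) u = v\<close>, where the left side lies in
  \<open>P i\<close> and the right side does not. Induction on the word gives injectivity.\<close>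

lemma (in group) ping_pong:
  assumes sub: "\<forall>K\<in>set Ks. subgroup K G"
    and disj: "\<And>i j. i < length Ks \<Longrightarrow> j < length Ks \<Longrightarrow> i \<noteq> j \<Longrightarrow> P i \<inter> P j = {}"
    and one: "\<And>i. i < length Ks \<Longrightarrow> \<one> \<notin> P i"
    and pong: "\<And>i g x. i < length Ks \<Longrightarrow> g \<in> Ks ! i \<Longrightarrow> g \<noteq> \<one> \<Longrightarrow>
      x \<in> carrier G \<Longrightarrow> x = \<one> \<or> (\<exists>j<length Ks. j \<noteq> i \<and> x \<in> P j) \<Longrightarrow> g \<otimes> x \<in> P i"
    and gen: "generate G (\<Union>(set Ks)) = carrier G"
  shows "free_factorization G Ks"
proof -
  let ?val = "\<lambda>w. foldr (\<lambda>p a. snd p \<otimes> a) w \<one>"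
  let ?W = "alternating_words G Ks"
  note cl = alternating_product_closed[OF sub]
  have syll: "i < length Ks \<and> g \<in> Ks ! i \<and> g \<noteq> \<one> \<and> g \<in> carrier G \<and> w \<in> ?W \<and> (w = [] \<or> fst (hd w) \<noteq> i)"
    if "(i, g) # w \<in> ?W" for i g w
    using that sub nth_mem[of i Ks] subgroup.mem_carrier[of "Ks ! i" G g]
    by (auto simp: alternating_words_def successively_Cons)
  have first: "w \<noteq> [] \<longrightarrow> ?val w \<in> P (fst (hd w))" if "w \<in> ?W" for w
    using that
  proof (induction w)
    case (Cons p w)
    obtain i g where p: "p = (i, g)" by (cases p)
    note s = syll[OF Cons.prems[unfolded p]]
    have w0: "w = [] \<or> fst (hd w) < length Ks"
      using s by (cases w) (auto simp: alternating_words_def)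
    have "?val w = \<one> \<or> (\<exists>j<length Ks. j \<noteq> i \<and> ?val w \<in> P j)"
      using s w0 Cons.IH by (cases "w = []") auto
    then have "g \<otimes> ?val w \<in> P i" using pong s cl by blast
    then show ?case using p by simp
  qed simp
  have inj: "\<forall>v\<in>?W. ?val u = ?val v \<longrightarrow> u = v" if "u \<in> ?W" for u
    using that
  proof (induction u)
    case Nil
    have "v = []" if "v \<in> ?W" "\<one> = ?val v" for v
      using that first[of v] one syll by (cases v) fastforce+
    then show ?case by fastforce
  next
    case (Cons p u)
    obtain i g where p: "p = (i, g)" by (cases p)
    note s = syll[OF Cons.prems[unfolded p]]
    show ?case
    proof (intro ballI impI)
      fix v assume v: "v \<in> ?W" and eq: "?val (p # u) = ?val v"
      have Pi: "?val v \<in> P i" using first[OF Cons.prems] eq p by simp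
      then have "v \<noteq> []" using one s by auto
      then obtain j h v' where v': "v = (j, h) # v'" by (cases v) auto
      note t = syll[OF v[unfolded v']]
      have "?val v \<in> P j" using first[OF v] v' by simp
      then have ij: "i = j" using Pi disj s t by blast
      have c: "?val u \<in> carrier G" "?val v' \<in> carrier G" using cl s t by auto
      have e: "g \<otimes> ?val u = h \<otimes> ?val v'" using eq p v' by simp
      have "g = h"
      proof (rule ccontr)
        \<comment> \<open>otherwise the same element lies in \<open>P i\<close> and is the value of a word that does not
          begin in the \<open>i\<close>-th factor\<close>
        assume ne: "g \<noteq> h"
        have Ki: "subgroup (Ks ! i) G" using sub s by simp
        have "inv h \<otimes> g \<in> Ks ! i"
          using s t ij Ki by (simp add: subgroup.m_closed subgroup.m_inv_closed)
        moreover have "inv h \<otimes> g \<noteq> \<one>" using ne s t by (metis inv_closed inv_equality inv_inv)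
        moreover have "?val u = \<one> \<or> (\<exists>j<length Ks. j \<noteq> i \<and> ?val u \<in> P j)"
          using s first[of u] by (cases u) (auto simp: alternating_words_def)
        ultimately have "(inv h \<otimes> g) \<otimes> ?val u \<in> P i"
          using pong[of i "inv h \<otimes> g" "?val u"] s c by blast
        moreover have "(inv h \<otimes> g) \<otimes> ?val u = ?val v'"
          using e c s t by (simp add: m_assoc inv_solve_left')
        moreover have "?val v' \<notin> P i"
        proof (cases "v' = []")
          case True then show ?thesis using one s by simp
        next
          case False
          then have "?val v' \<in> P (fst (hd v'))" "fst (hd v') < length Ks" "fst (hd v') \<noteq> i"
            using t ij first[of v'] by (cases v'; auto simp: alternating_words_def)+
          then show ?thesis using disj s by blast
        qed
        ultimately show False by simp
      qed
      moreover from this have "?val u = ?val v'" using e c s by simp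
      ultimately show "p # u = v" using Cons.IH s t p v' ij by blast
    qed
  qed
  have "?val ` ?W = carrier G"
    using cl alternating_product_exists[OF sub] gen by blast
  moreover have "inj_on ?val ?W" using inj unfolding inj_on_def by blast
  ultimately show ?thesis
    using sub unfolding free_factorization_def bij_betw_def by blast
qed

text \<open>Write the generators of the group in normal form and let \<open>C j\<close> collect their syllables in the
  \<open>j\<close>-th factor. The subgroups generated by the \<open>C j\<close> together generate everything, so each element
  of the \<open>i\<close>-th factor is the value of an alternating word in these smaller subgroups; by uniqueness
  this word has just one syllable, and the element is generated by \<open>C i\<close>.\<close>

lemma (in group) free_factor_finitely_generated:
  assumes ff: "free_factorization G Ks" and fg: "finitely_generated G (carrier G)"
    and K: "K \<in> set Ks"
  shows "finitely_generated G K"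
proof -
  let ?val = "\<lambda>w. foldr (\<lambda>p a. snd p \<otimes> a) w \<one>"
  obtain i where i: "i < length Ks" "K = Ks ! i" using K by (metis in_set_conv_nth)
  have sub: "\<forall>K\<in>set Ks. subgroup K G" and inj: "inj_on ?val (alternating_words G Ks)"
    and surj: "?val ` alternating_words G Ks = carrier G"
    using ff unfolding free_factorization_def bij_betw_def by auto
  have subi: "subgroup (Ks ! j) G" if "j < length Ks" for j using sub that by simp
  obtain A where A: "finite A" "A \<subseteq> carrier G" "generate G A = carrier G"
    using fg unfolding finitely_generated_def by blast
  have "\<exists>w\<in>alternating_words G Ks. ?val w = a" if "a \<in> A" for a
  proof -
    have "a \<in> ?val ` alternating_words G Ks" using surj A(2) that by blast
    then show ?thesis by (auto simp only: image_iff)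
  qed
  then obtain wd where wd: "\<And>a. a \<in> A \<Longrightarrow> wd a \<in> alternating_words G Ks" "\<And>a. a \<in> A \<Longrightarrow> ?val (wd a) = a"
    by metis
  define C where "C j = {g. \<exists>a\<in>A. (j, g) \<in> set (wd a)}" for j
  have finC: "finite (C j)" for j
  proof -
    have "C j \<subseteq> snd ` (\<Union>a\<in>A. set (wd a))" unfolding C_def by force
    then show ?thesis using A(1) by (meson List.finite_set finite_UN finite_imageI finite_subset)
  qed
  have CK: "C j \<subseteq> Ks ! j" for j
    using wd(1) unfolding C_def alternating_words_def by fastforce
  define Ks' where "Ks' = map (\<lambda>j. generate G (C j)) [0..<length Ks]"
  have incl: "generate G (C j) \<subseteq> Ks ! j" if "j < length Ks" for j
    using generate_subgroup_incl[OF CK subi[OF that]] .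
  have sub': "\<forall>K\<in>set Ks'. subgroup K G"
  proof
    fix L assume "L \<in> set Ks'"
    then obtain j where j: "j < length Ks" "L = generate G (C j)" unfolding Ks'_def by auto
    have "C j \<subseteq> carrier G" using CK subgroup.subset[OF subi[OF j(1)]] by blast
    then show "subgroup L G" using j generate_is_subgroup by simp
  qed
  have UG: "\<Union>(set Ks') \<subseteq> carrier G" using sub' subgroup.subset by blast
  have Agen: "A \<subseteq> generate G (\<Union>(set Ks'))"
  proof
    fix a assume a: "a \<in> A"
    have "set w \<subseteq> set (wd a) \<Longrightarrow> ?val w \<in> generate G (\<Union>(set Ks'))" for w
    proof (induction w)
      case Nil then show ?case by (simp add: generate.one)
    next
      case (Cons p w)
      obtain j g where p: "p = (j, g)" by (cases p)
      have jg: "(j, g) \<in> set (wd a)" using Cons.prems p by simp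
      then have "g \<in> C j" unfolding C_def using a by blast
      moreover have "j < length Ks" using wd(1)[OF a] jg by (auto simp: alternating_words_def)
      ultimately have "g \<in> \<Union>(set Ks')" unfolding Ks'_def by (auto intro: generate.incl)
      then have "g \<in> generate G (\<Union>(set Ks'))" by (rule generate.incl)
      then show ?case using Cons p by (auto intro: generate.eng)
    qed
    from this[of "wd a"] show "a \<in> generate G (\<Union>(set Ks'))" using wd(2)[OF a] by simp
  qed
  have gen: "carrier G \<subseteq> generate G (\<Union>(set Ks'))"
    using generate_subgroup_incl[OF Agen generate_is_subgroup[OF UG]] A(3) by simp
  have "K \<subseteq> generate G (C i)"
  proof
    fix k assume k: "k \<in> K"
    show "k \<in> generate G (C i)"
    proof (cases "k = \<one>")
      case True then show ?thesis by (simp add: generate.one)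
    next
      case False
      have kc: "k \<in> carrier G" using k i subi subgroup.mem_carrier by metis
      then obtain w where w: "w \<in> alternating_words G Ks'" "?val w = k"
        using alternating_product_exists[OF sub'] gen by blast
      have "w \<in> alternating_words G Ks"
        using w(1) incl unfolding alternating_words_def Ks'_def by fastforce
      moreover have "[(i, k)] \<in> alternating_words G Ks"
        using i k False by (simp add: alternating_words_def)
      moreover have "?val w = ?val [(i, k)]" using w(2) kc by simp
      ultimately have "w = [(i, k)]" using inj by (meson inj_onD)
      then show ?thesis using w(1) i(1) by (simp add: alternating_words_def Ks'_def)
    qed
  qed
  moreover have "generate G (C i) \<subseteq> K" using incl i by simp
  ultimately have "generate G (C i) = K" by simp
  moreover have "C i \<subseteq> K" using CK i by simp
  ultimately show ?thesis unfolding finitely_generated_def using finC[of i] by metis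
qed

text \<open>The witness is \<open>c = a b\<close> with \<open>a\<close> a nontrivial element of \<open>K\<close> and \<open>b\<close> one of another factor: the
  normal form of \<open>c ^ k\<close> has \<open>2 k\<close> syllables, that of an element of \<open>K\<close> at most one. For \<open>K\<close> trivial
  this argument fails, and the claim too: a finite group may be the other factor.\<close>

lemma (in group) proper_free_factor_avoids_powers:
  assumes ff: "free_factorization G Ks"
    and K: "K \<in> set Ks" "K \<noteq> carrier G" "K \<noteq> {\<one>}"
  shows "\<exists>c\<in>carrier G. \<forall>k>0. c [^] (k::nat) \<notin> K"
proof -
  let ?val = "\<lambda>w. foldr (\<lambda>p a. snd p \<otimes> a) w \<one>"
  obtain i where i: "i < length Ks" "K = Ks ! i" using K by (metis in_set_conv_nth)
  have sub: "\<forall>K\<in>set Ks. subgroup K G" and inj: "inj_on ?val (alternating_words G Ks)"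
    and surj: "?val ` alternating_words G Ks = carrier G"
    using ff unfolding free_factorization_def bij_betw_def by auto
  have subK: "subgroup K G" using sub K by simp
  obtain a where a: "a \<in> K" "a \<noteq> \<one>" using K(3) subgroup.one_closed[OF subK] by blast
  have "\<exists>j b. j < length Ks \<and> j \<noteq> i \<and> b \<in> Ks ! j \<and> b \<noteq> \<one>"
  proof (rule ccontr)
    assume none: "\<not> ?thesis"
    have "?val w \<in> K" if "w \<in> alternating_words G Ks" for w
      using that
    proof (induction w)
      case Nil then show ?case using subgroup.one_closed[OF subK] by simp
    next
      case (Cons p w)
      then have "w \<in> alternating_words G Ks" "fst p < length Ks" "snd p \<in> Ks ! fst p" "snd p \<noteq> \<one>"
        by (auto simp: alternating_words_def successively_Cons)
      moreover from this have "snd p \<in> K" using none i by blast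
      ultimately show ?case using Cons.IH subgroup.m_closed[OF subK] by simp
    qed
    then have "?val ` alternating_words G Ks \<subseteq> K" by (rule image_subsetI)
    then have "carrier G \<subseteq> K" using surj by simp
    then show False using K(2) subgroup.subset[OF subK] by blast
  qed
  then obtain j b where b: "j < length Ks" "j \<noteq> i" "b \<in> Ks ! j" "b \<noteq> \<one>" by blast
  have ac: "a \<in> carrier G" using a subgroup.mem_carrier[OF subK] by blast
  have bc: "b \<in> carrier G" using b sub by (meson nth_mem subgroup.mem_carrier)
  define W where "W k = concat (replicate k [(i, a), (j, b)])" for k :: nat
  have W: "W k \<in> alternating_words G Ks \<and> (k > 0 \<longrightarrow> hd (W k) = (i, a)) \<and> ?val (W k) = (a \<otimes> b) [^] k" for k
  proof (induction k)
    case 0 then show ?case by (simp add: W_def alternating_words_def)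
  next
    case (Suc k)
    have WS: "W (Suc k) = (i, a) # (j, b) # W k" by (simp add: W_def)
    have "W k = [] \<or> hd (W k) = (i, a)" using Suc by (cases k) (auto simp: W_def)
    then have "W (Suc k) \<in> alternating_words G Ks"
      using Suc WS a b i by (auto simp: alternating_words_def successively_Cons)
    moreover have "?val (W (Suc k)) = (a \<otimes> b) [^] Suc k"
      using Suc ac bc WS nat_pow_Suc2[of "a \<otimes> b" k] by (simp add: m_assoc del: nat_pow_Suc)
    ultimately show ?case using WS by simp
  qed
  have "(a \<otimes> b) [^] k \<notin> K" if k: "k > 0" for k :: nat
  proof
    assume mem: "(a \<otimes> b) [^] k \<in> K"
    obtain m where m: "k = Suc m" using k by (cases k) auto
    let ?x = "(a \<otimes> b) [^] k"
    have xc: "?x \<in> carrier G" using ac bc by simp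
    have len: "length (W k) \<ge> 2" unfolding m W_def by simp
    show False
    proof (cases "?x = \<one>")
      case True
      then have "?val (W k) = ?val []" using W by simp
      moreover have "[] \<in> alternating_words G Ks" by (simp add: alternating_words_def)
      ultimately have "W k = []" using W by (intro inj_onD[OF inj, of "W k" "[]"]) auto
      then show False using len by simp
    next
      case False
      then have "[(i, ?x)] \<in> alternating_words G Ks" using mem i by (simp add: alternating_words_def)
      moreover have "?val (W k) = ?val [(i, ?x)]" using W xc by simp
      ultimately have "W k = [(i, ?x)]" using W by (intro inj_onD[OF inj, of "W k" "[(i, ?x)]"]) auto
      then show False using len by simp
    qed
  qed
  then show ?thesis using ac bc by blast
qed

section \<open>Words in a free group\<close>

definition flip :: "'a letter \<Rightarrow> 'a letter" where
  "flip p = (fst p, \<not> snd p)"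

lemma flip_letter [simp]: "flip p \<in> X \<times> UNIV \<longleftrightarrow> p \<in> X \<times> UNIV"
  by (cases p) (simp add: flip_def)

lemma cancelling_iff_flip: "cancelling p q \<longleftrightarrow> q = flip p"
  by (cases p; cases q) (auto simp: cancelling_def flip_def)

definition inverse_word :: "'a letter list \<Rightarrow> 'a letter list" where
  "inverse_word w = rev (map flip w)"

lemma inverse_word_simps [simp]:
  "inverse_word [] = []" "inverse_word (p # w) = inverse_word w @ [flip p]"
  by (simp_all add: inverse_word_def)

lemma inverse_word_letters [simp]: "set (inverse_word w) \<subseteq> X \<times> UNIV \<longleftrightarrow> set w \<subseteq> X \<times> UNIV"
  by (induction w) auto

lemma reduced_word_letters: "w \<in> reduced_words X \<Longrightarrow> set w \<subseteq> X \<times> UNIV"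
  by (simp add: reduced_words_def)

lemma reduced_words_Nil [simp]: "[] \<in> reduced_words X"
  by (simp add: reduced_words_def)

lemma reduced_words_Cons:
  "p # w \<in> reduced_words X \<longleftrightarrow>
    p \<in> X \<times> UNIV \<and> w \<in> reduced_words X \<and> (w = [] \<or> hd w \<noteq> flip p)"
  by (auto simp: reduced_words_def successively_Cons cancelling_iff_flip)

lemma word_value_simps [simp]:
  "word_value G [] = \<one>\<^bsub>G\<^esub>"
  "word_value G (p # w) = letter_value G p \<otimes>\<^bsub>G\<^esub> word_value G w"
  by (simp_all add: word_value_def)

locale free_group = group G for G :: "('a, 'm) monoid_scheme" (structure) +
  fixes X :: "'a set"
  assumes basis: "free_basis G X"
begin

abbreviation nf :: "'a \<Rightarrow> 'a letter list" where
  "nf \<equiv> normal_form G X"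

lemma letter_value_closed [simp]: "p \<in> X \<times> UNIV \<Longrightarrow> letter_value G p \<in> carrier G"
  using basis unfolding free_basis_def letter_value_def by (cases p) auto

lemma letter_value_flip: "p \<in> X \<times> UNIV \<Longrightarrow> letter_value G (flip p) = inv (letter_value G p)"
  using basis unfolding free_basis_def letter_value_def flip_def by (cases p) auto

lemma word_value_closed [simp]: "set w \<subseteq> X \<times> UNIV \<Longrightarrow> word_value G w \<in> carrier G"
  by (induction w) auto

lemma word_value_append:
  "set u \<subseteq> X \<times> UNIV \<Longrightarrow> set v \<subseteq> X \<times> UNIV \<Longrightarrow>
    word_value G (u @ v) = word_value G u \<otimes> word_value G v"
proof (induction u)
  case (Cons p u)
  then have "p \<in> X \<times> UNIV" "set u \<subseteq> X \<times> UNIV" by auto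
  then show ?case using Cons by (simp add: m_assoc)
qed simp

lemma word_value_inverse:
  "set w \<subseteq> X \<times> UNIV \<Longrightarrow> word_value G (inverse_word w) = inv (word_value G w)"
proof (induction w)
  case (Cons p w)
  then have p: "p \<in> X \<times> UNIV" "set w \<subseteq> X \<times> UNIV" by auto
  have "word_value G (inverse_word w @ [flip p]) = inv (word_value G w) \<otimes> letter_value G (flip p)"
    using Cons.IH p by (subst word_value_append) auto
  then show ?case using p by (simp add: letter_value_flip inv_mult_group)
qed simp

lemma bij_word_value: "bij_betw (word_value G) (reduced_words X) (carrier G)"
  using basis by (simp add: free_basis_def)

lemma nf_reduced [simp]: "g \<in> carrier G \<Longrightarrow> nf g \<in> reduced_words X"
  using bij_word_value unfolding normal_form_def bij_betw_def
  by (metis order_refl the_inv_into_into)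

lemma nf_letters [simp]: "g \<in> carrier G \<Longrightarrow> set (nf g) \<subseteq> X \<times> UNIV"
  using nf_reduced by (rule reduced_word_letters)

lemma word_value_nf [simp]: "g \<in> carrier G \<Longrightarrow> word_value G (nf g) = g"
  using bij_word_value unfolding normal_form_def bij_betw_def
  by (metis f_the_inv_into_f)

lemma nf_word_value: "w \<in> reduced_words X \<Longrightarrow> nf (word_value G w) = w"
  using bij_word_value unfolding normal_form_def bij_betw_def
  by (metis the_inv_into_f_f)

lemma carrier_finitely_generated:
  assumes "finite X"
  shows "finitely_generated G (carrier G)"
proof -
  have X: "X \<subseteq> carrier G" using basis by (simp add: free_basis_def)
  have "word_value G w \<in> generate G X" if "set w \<subseteq> X \<times> UNIV" for w
    using that
  proof (induction w)
    case Nil then show ?case by (simp add: generate.one)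
  next
    case (Cons p w)
    have "letter_value G p \<in> generate G X"
      using Cons.prems by (auto simp: letter_value_def intro: generate.incl generate.inv)
    then show ?case using Cons by (auto intro: generate.eng)
  qed
  then have "g \<in> generate G X" if "g \<in> carrier G" for g
    using that nf_letters word_value_nf by metis
  then have "generate G X = carrier G" using generate_incl[OF X] by blast
  then show ?thesis unfolding finitely_generated_def using assms X by blast
qed

lemma basis_element_infinite_order:
  assumes "x \<in> X" "k > 0"
  shows "x [^] (k::nat) \<noteq> \<one>"
proof
  assume eq: "x [^] k = \<one>"
  have xc: "x \<in> carrier G" using basis assms(1) by (auto simp: free_basis_def)
  have red: "replicate n (x, True) \<in> reduced_words X" for n :: nat
    using assms(1) by (induction n) (auto simp: reduced_words_Cons flip_def hd_replicate)
  have val: "word_value G (replicate n (x, True)) = x [^] n" for n :: nat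
  proof (induction n)
    case (Suc n) then show ?case using xc nat_pow_Suc2[of x n] by (simp add: letter_value_def)
  qed simp
  have "replicate k (x, True) = nf \<one>" using nf_word_value[OF red] val eq by metis
  moreover have "nf \<one> = []" using nf_word_value[of "[]"] by simp
  ultimately show False using assms(2) by simp
qed

end

section \<open>Pointed coverings of a rose\<close>

text \<open>The edges \<open>q \<rightarrow> step q p\<close>, labelled by the letters \<open>p\<close>, make \<open>Q\<close> a covering graph of the rose with
  petals \<open>X\<close>, with base vertex \<open>\<one>\<close>. The vertices are group elements, chosen as in a Schreier
  transversal: an edge is called a tree edge if it leads from \<open>q\<close> to \<open>q p\<close> in the group, and the last
  assumption says that tree edges connect all vertices to the base.\<close>

locale pointed_covering = free_group +
  fixes Q :: "'a set" and step :: "'a \<Rightarrow> 'a letter \<Rightarrow> 'a"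
  assumes Q_subset: "Q \<subseteq> carrier G"
    and one_Q: "\<one> \<in> Q"
    and step_Q: "q \<in> Q \<Longrightarrow> p \<in> X \<times> UNIV \<Longrightarrow> step q p \<in> Q"
    and step_flip: "q \<in> Q \<Longrightarrow> p \<in> X \<times> UNIV \<Longrightarrow> step (step q p) (flip p) = q"
    and tree_path: "q \<in> Q \<Longrightarrow> \<exists>w. set w \<subseteq> X \<times> UNIV \<and> foldl step \<one> w = q \<and>
      (\<forall>u p v. w = u @ p # v \<longrightarrow>
        step (foldl step \<one> u) p = foldl step \<one> u \<otimes> letter_value G p)"
begin

text \<open>The Schreier generator of an edge. It is \<open>\<one>\<close> exactly for tree edges, and reversing the edge
  inverts it. Edges will be sorted by their weights, and the value of a closed path at \<open>\<one>\<close> is the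
  product of the weights along it.\<close>

definition weight :: "'a \<Rightarrow> 'a letter \<Rightarrow> 'a" where
  "weight q p = q \<otimes> letter_value G p \<otimes> inv (step q p)"

primrec weights :: "'a \<Rightarrow> 'a letter list \<Rightarrow> 'a list" where
  "weights q [] = []"
| "weights q (p # w) = weight q p # weights (step q p) w"

primrec first_weight :: "'a \<Rightarrow> 'a letter list \<Rightarrow> 'a" where
  "first_weight q [] = \<one>"
| "first_weight q (p # w) = (if weight q p = \<one> then first_weight (step q p) w else weight q p)"

lemma Q_closed: "q \<in> Q \<Longrightarrow> q \<in> carrier G"
  using Q_subset by blast

lemma weight_closed: "q \<in> Q \<Longrightarrow> p \<in> X \<times> UNIV \<Longrightarrow> weight q p \<in> carrier G"
  using step_Q Q_closed unfolding weight_def by simp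

lemma weight_one_iff:
  assumes "q \<in> Q" "p \<in> X \<times> UNIV"
  shows "weight q p = \<one> \<longleftrightarrow> step q p = q \<otimes> letter_value G p"
proof -
  have "q \<in> carrier G" "step q p \<in> carrier G" "letter_value G p \<in> carrier G"
    using assms step_Q Q_closed by simp_all
  then show ?thesis unfolding weight_def by (metis inv_closed inv_equality inv_inv m_closed r_inv)
qed

lemma weight_flip:
  assumes "q \<in> Q" "p \<in> X \<times> UNIV"
  shows "weight (step q p) (flip p) = inv (weight q p)"
proof -
  have "q \<in> carrier G" "step q p \<in> carrier G" "letter_value G p \<in> carrier G"
    using assms step_Q Q_closed by simp_all
  then show ?thesis unfolding weight_def
    using assms by (simp add: step_flip letter_value_flip inv_mult_group m_assoc)
qed

lemma end_Q: "q \<in> Q \<Longrightarrow> set w \<subseteq> X \<times> UNIV \<Longrightarrow> foldl step q w \<in> Q"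
  by (induction w arbitrary: q) (auto simp: step_Q)

lemma weights_append: "weights q (u @ v) = weights q u @ weights (foldl step q u) v"
  by (induction u arbitrary: q) auto

lemma first_weight_append:
  "first_weight q (u @ v) =
    (if first_weight q u = \<one> then first_weight (foldl step q u) v else first_weight q u)"
  by (induction u arbitrary: q) auto

lemma first_weight_mem: "first_weight q w \<noteq> \<one> \<Longrightarrow> first_weight q w \<in> set (weights q w)"
  by (induction w arbitrary: q) (auto split: if_splits)

lemma end_inverse_word:
  "q \<in> Q \<Longrightarrow> set w \<subseteq> X \<times> UNIV \<Longrightarrow> foldl step (foldl step q w) (inverse_word w) = q"
proof (induction w arbitrary: q)
  case (Cons p w)
  then show ?case using Cons.IH[of "step q p"] by (simp add: step_Q step_flip)
qed simp

lemma weights_inverse_word: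
  "q \<in> Q \<Longrightarrow> set w \<subseteq> X \<times> UNIV \<Longrightarrow>
    set (weights (foldl step q w) (inverse_word w)) = m_inv G ` set (weights q w)"
proof (induction w arbitrary: q)
  case (Cons p w)
  then have "step q p \<in> Q" "p \<in> X \<times> UNIV" "set w \<subseteq> X \<times> UNIV" by (auto simp: step_Q)
  then show ?case using Cons.IH[of "step q p"] Cons.prems(1)
    by (simp add: weights_append end_inverse_word weight_flip)
qed simp

text \<open>The element in the conclusion is the product of the weights along the path.\<close>

lemma word_value_mem_subgroup:
  assumes C: "subgroup C G"
  shows "q \<in> Q \<Longrightarrow> set w \<subseteq> X \<times> UNIV \<Longrightarrow> set (weights q w) \<subseteq> C \<Longrightarrow>
    q \<otimes> word_value G w \<otimes> inv (foldl step q w) \<in> C"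
proof (induction w arbitrary: q)
  case Nil then show ?case using subgroup.one_closed[OF C] Q_closed by simp
next
  case (Cons p w)
  then have p: "p \<in> X \<times> UNIV" "set w \<subseteq> X \<times> UNIV" "step q p \<in> Q" by (auto simp: step_Q)
  define e where "e = foldl step (step q p) w"
  have c: "q \<in> carrier G" "step q p \<in> carrier G" "letter_value G p \<in> carrier G"
    "word_value G w \<in> carrier G" "e \<in> carrier G"
    using p Cons.prems Q_closed end_Q unfolding e_def by simp_all
  have "step q p \<otimes> word_value G w \<otimes> inv e \<in> C" "weight q p \<in> C"
    using Cons p unfolding e_def by simp_all
  then have "weight q p \<otimes> (step q p \<otimes> word_value G w \<otimes> inv e) \<in> C"
    using subgroup.m_closed[OF C] by blast
  also have "weight q p \<otimes> (step q p \<otimes> word_value G w \<otimes> inv e)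
      = q \<otimes> (letter_value G p \<otimes> word_value G w) \<otimes> inv e"
  proof -
    have "inv (step q p) \<otimes> (step q p \<otimes> (word_value G w \<otimes> inv e)) = word_value G w \<otimes> inv e"
      using c by (simp add: m_assoc[symmetric])
    then show ?thesis unfolding weight_def using c by (simp add: m_assoc)
  qed
  finally show ?case by (simp add: e_def)
qed

lemma tree_word_value:
  assumes "q \<in> Q" "set w \<subseteq> X \<times> UNIV" "set (weights q w) \<subseteq> {\<one>}"
  shows "q \<otimes> word_value G w = foldl step q w"
proof -
  have "q \<otimes> word_value G w \<otimes> inv (foldl step q w) \<in> {\<one>}"
    using assms triv_subgroup by (intro word_value_mem_subgroup) auto
  then show ?thesis using assms Q_closed end_Q
    by (metis inv_closed inv_equality inv_inv m_closed singletonD word_value_closed)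
qed

lemma tree_word:
  assumes "q \<in> Q"
  obtains w where "set w \<subseteq> X \<times> UNIV" "foldl step \<one> w = q" "set (weights \<one> w) \<subseteq> {\<one>}"
    "word_value G w = q"
proof -
  obtain w where w: "set w \<subseteq> X \<times> UNIV" "foldl step \<one> w = q"
    "\<And>u p v. w = u @ p # v \<Longrightarrow> step (foldl step \<one> u) p = foldl step \<one> u \<otimes> letter_value G p"
    using tree_path[OF assms] by blast
  have "set v \<subseteq> X \<times> UNIV \<Longrightarrow> w = v @ v' \<Longrightarrow> set (weights \<one> v) \<subseteq> {\<one>}" for v v'
  proof (induction v arbitrary: v' rule: rev_induct)
    case (snoc p v)
    then have "p \<in> X \<times> UNIV" "foldl step \<one> v \<in> Q" "weight (foldl step \<one> v) p = \<one>"
      using w(3)[of v p v'] end_Q[OF one_Q, of v] weight_one_iff[of "foldl step \<one> v" p]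
      by auto
    then show ?case using snoc by (simp add: weights_append)
  qed simp
  from this[of w "[]"] have "set (weights \<one> w) \<subseteq> {\<one>}" using w(1) by simp
  then show thesis using that w tree_word_value[OF one_Q w(1)] by simp
qed

text \<open>Free reduction deletes an edge followed by its reverse, so it keeps the endpoint and creates no
  new edges. Hence path properties of a word pass to the normal form of its value.\<close>

lemma reduce_word:
  "q \<in> Q \<Longrightarrow> set w \<subseteq> X \<times> UNIV \<Longrightarrow>
    \<exists>m\<in>reduced_words X. word_value G m = word_value G w \<and>
      foldl step q m = foldl step q w \<and> set (weights q m) \<subseteq> set (weights q w)"
proof (induction w arbitrary: q)
  case Nil then show ?case using reduced_words_Nil by fastforce
next
  case (Cons p w)
  then have p: "p \<in> X \<times> UNIV" "set w \<subseteq> X \<times> UNIV" "step q p \<in> Q" by (auto simp: step_Q)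
  obtain m where m: "m \<in> reduced_words X" "word_value G m = word_value G w"
    "foldl step (step q p) m = foldl step (step q p) w"
    "set (weights (step q p) m) \<subseteq> set (weights (step q p) w)"
    using Cons.IH[OF p(3,2)] by blast
  show ?case
  proof (cases "m \<noteq> [] \<and> hd m = flip p")
    case True
    then obtain t where t: "m = flip p # t" by (cases m) auto
    have "t \<in> reduced_words X" "set t \<subseteq> X \<times> UNIV"
      using m(1) t by (auto simp: reduced_words_Cons dest: reduced_word_letters)
    moreover have "word_value G t = word_value G (p # w)"
      using m(2)[symmetric] t p \<open>set t \<subseteq> X \<times> UNIV\<close>
      by (simp add: letter_value_flip m_assoc[symmetric])
    moreover have "foldl step q t = foldl step q (p # w)" "set (weights q t) \<subseteq> set (weights q (p # w))"
      using m(3,4) t step_flip[OF Cons.prems(1) p(1)] by auto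
    ultimately show ?thesis by blast
  next
    case False
    then have "p # m \<in> reduced_words X" using p(1) m(1) by (auto simp: reduced_words_Cons)
    then show ?thesis using m(2-4) by (intro bexI[of _ "p # m"]) auto
  qed
qed

lemma nf_path:
  assumes "q \<in> Q" "set w \<subseteq> X \<times> UNIV"
  shows "foldl step q (nf (word_value G w)) = foldl step q w"
    and "set (weights q (nf (word_value G w))) \<subseteq> set (weights q w)"
  using reduce_word[OF assms] nf_word_value by metis+

text \<open>Multiplying by a tree path from the left only adds or cancels tree edges, because the reverse of
  a tree edge is a tree edge. So the first edge outside the tree survives.\<close>

lemma tree_word_mult:
  assumes r: "r \<in> reduced_words X"
  shows "q \<in> Q \<Longrightarrow> set w \<subseteq> X \<times> UNIV \<Longrightarrow> set (weights q w) \<subseteq> {\<one>} \<Longrightarrow>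
    \<exists>m\<in>reduced_words X. word_value G m = word_value G w \<otimes> word_value G r \<and>
      first_weight q m = first_weight (foldl step q w) r"
proof (induction w arbitrary: q)
  case Nil then show ?case using r reduced_word_letters[OF r] by (intro bexI[of _ r]) auto
next
  case (Cons p w)
  then have p: "p \<in> X \<times> UNIV" "set w \<subseteq> X \<times> UNIV" "step q p \<in> Q" "weight q p = \<one>"
    "set (weights (step q p) w) \<subseteq> {\<one>}" by (auto simp: step_Q)
  note rl = reduced_word_letters[OF r]
  obtain m where m: "m \<in> reduced_words X" "word_value G m = word_value G w \<otimes> word_value G r"
    "first_weight (step q p) m = first_weight (foldl step (step q p) w) r"
    using Cons.IH[OF p(3,2,5)] by blast
  show ?case
  proof (cases "m \<noteq> [] \<and> hd m = flip p")
    case True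
    then obtain t where t: "m = flip p # t" by (cases m) auto
    have tr: "t \<in> reduced_words X" "set t \<subseteq> X \<times> UNIV"
      using m(1) t by (auto simp: reduced_words_Cons dest: reduced_word_letters)
    have "letter_value G p \<otimes> (letter_value G (flip p) \<otimes> word_value G t) = word_value G t"
      using p(1) tr(2) by (simp add: letter_value_flip m_assoc[symmetric])
    then have "word_value G t = letter_value G p \<otimes> (word_value G w \<otimes> word_value G r)"
      using m(2) t by simp
    then have "word_value G t = word_value G (p # w) \<otimes> word_value G r"
      using p rl by (simp add: m_assoc)
    moreover have "first_weight q t = first_weight (foldl step q (p # w)) r"
      using m(3) t p(4) weight_flip[OF Cons.prems(1) p(1)] step_flip[OF Cons.prems(1) p(1)] by simp
    ultimately show ?thesis using tr by blast
  next
    case False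
    then have "p # m \<in> reduced_words X" using p(1) m(1) by (auto simp: reduced_words_Cons)
    then show ?thesis using m(2,3) p rl
      by (intro bexI[of _ "p # m"]) (auto simp: m_assoc)
  qed
qed

lemma last_nontree_step:
  "\<not> set (weights q w) \<subseteq> {\<one>} \<Longrightarrow>
    \<exists>u p v. w = u @ p # v \<and> weight (foldl step q u) p \<noteq> \<one> \<and>
      set (weights (step (foldl step q u) p) v) \<subseteq> {\<one>}"
proof (induction w arbitrary: q)
  case (Cons p w)
  show ?case
  proof (cases "set (weights (step q p) w) \<subseteq> {\<one>}")
    case True
    then have "weight q p \<noteq> \<one>" using Cons.prems by auto
    then show ?thesis using True by (intro exI[of _ "[]"]) auto
  next
    case False
    from Cons.IH[OF this] obtain u p' v where "w = u @ p' # v"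
      "weight (foldl step (step q p) u) p' \<noteq> \<one>"
      "set (weights (step (foldl step (step q p) u) p') v) \<subseteq> {\<one>}" by blast
    then show ?thesis by (intro exI[of _ "p # u"]) auto
  qed
qed simp

text \<open>The image in \<open>G\<close> of the fundamental group, at \<open>\<one>\<close>, of the subgraph of edges with weight in
  \<open>C\<close>.\<close>

definition loops :: "'a set \<Rightarrow> 'a set" where
  "loops C = {g \<in> carrier G. foldl step \<one> (nf g) = \<one> \<and> set (weights \<one> (nf g)) \<subseteq> C}"

lemma loopsI:
  assumes "set w \<subseteq> X \<times> UNIV" "foldl step \<one> w = \<one>" "set (weights \<one> w) \<subseteq> C"
  shows "word_value G w \<in> loops C"
  using assms nf_path[OF one_Q assms(1)] unfolding loops_def by auto

lemma loops_subgroup: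
  assumes C: "\<And>c. c \<in> C \<Longrightarrow> inv c \<in> C"
  shows "subgroup (loops C) G"
proof (rule subgroupI)
  show "loops C \<subseteq> carrier G" by (auto simp: loops_def)
  show "loops C \<noteq> {}" using loopsI[of "[]" C] by auto
next
  fix g assume g: "g \<in> loops C"
  then have gc: "g \<in> carrier G" and e: "foldl step \<one> (nf g) = \<one>" and s: "set (weights \<one> (nf g)) \<subseteq> C"
    by (auto simp: loops_def)
  have "word_value G (inverse_word (nf g)) \<in> loops C"
  proof (rule loopsI)
    show "foldl step \<one> (inverse_word (nf g)) = \<one>"
      using end_inverse_word[OF one_Q nf_letters[OF gc]] e by simp
    show "set (weights \<one> (inverse_word (nf g))) \<subseteq> C"
      using weights_inverse_word[OF one_Q nf_letters[OF gc]] e s C by auto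
  qed (use gc in simp)
  then show "inv g \<in> loops C" using gc by (simp add: word_value_inverse)
next
  fix g h assume "g \<in> loops C" "h \<in> loops C"
  then have "word_value G (nf g @ nf h) \<in> loops C"
    by (intro loopsI) (auto simp: loops_def weights_append dest!: nf_letters)
  then show "g \<otimes> h \<in> loops C"
    using \<open>g \<in> loops C\<close> \<open>h \<in> loops C\<close> by (simp add: loops_def word_value_append)
qed

text \<open>The closed path runs from \<open>\<one>\<close> to \<open>q\<close> in the tree, along the edge, and back in the tree.\<close>

lemma weight_mem_loops:
  assumes q: "q \<in> Q" and p: "p \<in> X \<times> UNIV" and C: "\<one> \<in> C" "weight q p \<in> C"
  shows "weight q p \<in> loops C"
proof -
  obtain u where u: "set u \<subseteq> X \<times> UNIV" "foldl step \<one> u = q" "set (weights \<one> u) \<subseteq> {\<one>}"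
    "word_value G u = q" using tree_word[OF q] .
  have q': "step q p \<in> Q" using q p by (rule step_Q)
  obtain v where v: "set v \<subseteq> X \<times> UNIV" "foldl step \<one> v = step q p" "set (weights \<one> v) \<subseteq> {\<one>}"
    "word_value G v = step q p" using tree_word[OF q'] .
  have "word_value G (u @ p # inverse_word v) \<in> loops C"
  proof (rule loopsI)
    show "set (u @ p # inverse_word v) \<subseteq> X \<times> UNIV"
      using u(1) p inverse_word_letters[of v X] v(1) by simp
    show "foldl step \<one> (u @ p # inverse_word v) = \<one>"
      using end_inverse_word[OF one_Q v(1)] u(2) v(2) by simp
    have "set (weights (step q p) (inverse_word v)) \<subseteq> {\<one>}"
      using weights_inverse_word[OF one_Q v(1)] v(2,3) by force
    then show "set (weights \<one> (u @ p # inverse_word v)) \<subseteq> C"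
      using u(2,3) C by (auto simp: weights_append)
  qed
  also have "word_value G (u @ p # inverse_word v) = q \<otimes> (letter_value G p \<otimes> inv (step q p))"
    using u p v inverse_word_letters[of v X] by (simp add: word_value_append word_value_inverse)
  also have "\<dots> = weight q p"
    unfolding weight_def using Q_closed[OF q] Q_closed[OF q'] p by (simp add: m_assoc)
  finally show ?thesis .
qed

text \<open>The move of the ping-pong game. Let \<open>p\<close> be the last edge outside the tree on the path of \<open>a\<close>; there
  is one, since a closed tree path has value \<open>\<one>\<close>. What follows \<open>p\<close> in \<open>a\<close> is a tree path, so after
  multiplying it with \<open>h\<close> the first edge outside the tree is still that of \<open>h\<close>, with weight outside
  \<open>C\<close> if it exists. Cancelling \<open>p\<close> would require that this first edge be the reverse of \<open>p\<close>, whose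
  weight lies in \<open>C\<close>. So the normal form of \<open>a h\<close> begins with that of \<open>a\<close> up to \<open>p\<close>, and the
  first edge outside the tree is the same for both.\<close>

lemma first_weight_mult:
  assumes C: "\<And>c. c \<in> C \<Longrightarrow> inv c \<in> C"
    and a: "a \<in> loops C" "a \<noteq> \<one>"
    and h: "h \<in> carrier G" "first_weight \<one> (nf h) = \<one> \<or> first_weight \<one> (nf h) \<notin> C"
  shows "first_weight \<one> (nf (a \<otimes> h)) \<in> C - {\<one>}"
proof -
  have ac: "a \<in> carrier G" and ea: "foldl step \<one> (nf a) = \<one>" and sa: "set (weights \<one> (nf a)) \<subseteq> C"
    using a(1) by (auto simp: loops_def)
  have "\<not> set (weights \<one> (nf a)) \<subseteq> {\<one>}"
    using tree_word_value[OF one_Q nf_letters[OF ac]] ea ac a(2) by auto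
  then obtain u p v where uv: "nf a = u @ p # v" and p1: "weight (foldl step \<one> u) p \<noteq> \<one>"
    and v1: "set (weights (step (foldl step \<one> u) p) v) \<subseteq> {\<one>}"
    using last_nontree_step by blast
  define s where "s = foldl step \<one> u"
  have l: "set u \<subseteq> X \<times> UNIV" "p \<in> X \<times> UNIV" "set v \<subseteq> X \<times> UNIV"
    using nf_letters[OF ac] unfolding uv by auto
  have sQ: "s \<in> Q" unfolding s_def using one_Q l(1) by (rule end_Q)
  have tQ: "step s p \<in> Q" using sQ l(2) by (rule step_Q)
  have ev: "foldl step (step s p) v = \<one>" using ea uv by (simp add: s_def)
  have wC: "weight s p \<in> C" using sa uv by (simp add: weights_append s_def)
  obtain m where m: "m \<in> reduced_words X" "word_value G m = word_value G v \<otimes> word_value G (nf h)"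
    "first_weight (step s p) m = first_weight \<one> (nf h)"
    using tree_word_mult[OF nf_reduced[OF h(1)] tQ l(3)] v1 ev by (auto simp: s_def)
  have nocancel: "m = [] \<or> hd m \<noteq> flip p"
  proof (rule ccontr)
    assume "\<not> ?thesis"
    then obtain t where "m = flip p # t" by (cases m) auto
    moreover have "weight (step s p) (flip p) = inv (weight s p)"
      using sQ l(2) by (rule weight_flip)
    moreover have "inv (weight s p) \<noteq> \<one>"
      using p1 weight_closed[OF sQ l(2)] inv_eq_1_iff unfolding s_def by blast
    ultimately have "first_weight (step s p) m \<in> C" "first_weight (step s p) m \<noteq> \<one>"
      using C[OF wC] by simp_all
    then show False using m(3) h(2) by simp
  qed
  have ml: "set m \<subseteq> X \<times> UNIV" using m(1) by (rule reduced_word_letters)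
  have red: "u @ p # m \<in> reduced_words X"
    using nf_reduced[OF ac] m(1) nocancel unfolding uv
    by (auto simp: reduced_words_def successively_append_iff successively_Cons cancelling_iff_flip)
  have "word_value G (u @ p # m) = word_value G (u @ p # v) \<otimes> word_value G (nf h)"
    using l ml m(2) nf_letters[OF h(1)] h(1)
    by (simp add: word_value_append m_assoc)
  also have "\<dots> = a \<otimes> h" using word_value_nf[OF ac] h(1) uv by simp
  finally have "nf (a \<otimes> h) = u @ p # m" using nf_word_value[OF red] by simp
  then have nf: "nf (a \<otimes> h) = (u @ [p]) @ m" by simp
  have ne: "first_weight \<one> (u @ [p]) \<noteq> \<one>"
    using p1 by (simp add: first_weight_append)
  have "first_weight \<one> (u @ [p]) \<in> set (weights \<one> (u @ [p]))"
    using ne by (rule first_weight_mem)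
  also have "\<dots> \<subseteq> C" using sa unfolding uv by (auto simp: weights_append)
  finally show ?thesis using ne unfolding nf by (simp only: first_weight_append[of _ "u @ [p]"]) simp
qed

text \<open>This is van Kampen's theorem for two subgraphs that cover the graph and meet in a maximal tree:
  the edges with weight in \<open>K\<close>, and the tree edges together with the edges with weight outside
  \<open>K\<close>. The ping-pong sets sort the elements by the subgraph that contains the first edge outside the
  tree.\<close>

lemma loops_free_factorization:
  assumes K: "subgroup K G"
  shows "free_factorization (G\<lparr>carrier := loops (carrier G)\<rparr>)
    [loops K, loops (insert \<one> (carrier G - K))]"
proof -
  define H where "H = loops (carrier G)"
  define C where "C i = (if i = 0 then K else insert \<one> (carrier G - K))" for i :: nat
  define P where "P i = {h. first_weight \<one> (nf h) \<in> C i - {\<one>}}" for i :: nat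
  have KG: "K \<subseteq> carrier G" using K by (rule subgroup.subset)
  have K1: "\<one> \<in> K" using K by (rule subgroup.one_closed)
  have CG: "C i \<subseteq> carrier G" for i using KG by (auto simp: C_def)
  have C1: "\<one> \<in> C i" for i using K1 by (simp add: C_def)
  have Cinv: "inv c \<in> C i" if "c \<in> C i" for c i
    using that subgroup.m_inv_closed[OF K] by (auto simp: C_def split: if_splits) (metis inv_inv)
  have H: "subgroup H G" unfolding H_def by (rule loops_subgroup) simp
  interpret H: group "G\<lparr>carrier := H\<rparr>" using H by (rule subgroup_imp_group)
  define Ks where "Ks = [loops K, loops (insert \<one> (carrier G - K))]"
  have Ks_nth: "i < length Ks \<Longrightarrow> Ks ! i = loops (C i)" for i
    by (cases i) (auto simp: Ks_def C_def)
  have Cdisj: "C i \<inter> C j = {\<one>}" if "i < length Ks" "j < length Ks" "i \<noteq> j" for i j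
    using that K1 by (auto simp: C_def Ks_def)
  have LH: "loops (C i) \<subseteq> H" for i using CG unfolding H_def loops_def by blast
  have sub: "subgroup L (G\<lparr>carrier := H\<rparr>)" if L: "L \<in> set Ks" for L
  proof -
    obtain i where "i < length Ks" "L = loops (C i)" using L Ks_nth by (metis in_set_conv_nth)
    then show ?thesis using subgroup_incl[OF loops_subgroup H LH] Cinv by blast
  qed
  have "free_factorization (G\<lparr>carrier := H\<rparr>) Ks"
  proof (rule H.ping_pong[where P = P])
    show "\<forall>L\<in>set Ks. subgroup L (G\<lparr>carrier := H\<rparr>)" using sub by blast
    show "P i \<inter> P j = {}" if "i < length Ks" "j < length Ks" "i \<noteq> j" for i j
      using Cdisj[OF that] by (auto simp: P_def)
    have nf1: "nf \<one> = []" using nf_word_value[of "[]"] by simp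
    show "\<one>\<^bsub>G\<lparr>carrier := H\<rparr>\<^esub> \<notin> P i" for i by (simp add: P_def nf1)
    show "g \<otimes>\<^bsub>G\<lparr>carrier := H\<rparr>\<^esub> x \<in> P i"
      if "i < length Ks" "g \<in> Ks ! i" "g \<noteq> \<one>\<^bsub>G\<lparr>carrier := H\<rparr>\<^esub>" "x \<in> carrier (G\<lparr>carrier := H\<rparr>)"
        "x = \<one>\<^bsub>G\<lparr>carrier := H\<rparr>\<^esub> \<or> (\<exists>j<length Ks. j \<noteq> i \<and> x \<in> P j)" for i g x
    proof -
      have "first_weight \<one> (nf x) = \<one> \<or> first_weight \<one> (nf x) \<notin> C i"
        using that(1,5) Cdisj nf1 by (fastforce simp: P_def)
      moreover have "x \<in> carrier G" using that(4) subgroup.subset[OF H] by auto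
      moreover have "g \<in> loops (C i)" using that(1,2) Ks_nth by simp
      ultimately show ?thesis using first_weight_mult[OF Cinv, where a = g] that(3) by (simp add: P_def)
    qed
    have UH: "\<Union>(set Ks) \<subseteq> H"
      using LH[of 0] LH[of 1] by (simp add: Ks_def C_def)
    have UG: "\<Union>(set Ks) \<subseteq> carrier G" using UH subgroup.subset[OF H] by blast
    have "H \<subseteq> generate G (\<Union>(set Ks))"
    proof
      fix h assume "h \<in> H"
      then have hc: "h \<in> carrier G" and eh: "foldl step \<one> (nf h) = \<one>"
        by (auto simp: H_def loops_def)
      have wt: "weight q p \<in> generate G (\<Union>(set Ks))" if "q \<in> Q" "p \<in> X \<times> UNIV" for q p
      proof -
        have "weight q p \<in> loops K \<or> weight q p \<in> loops (insert \<one> (carrier G - K))"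
          using weight_mem_loops[OF that, of K] weight_closed[OF that] K1
            weight_mem_loops[OF that, of "insert \<one> (carrier G - K)"]
          by (cases "weight q p \<in> K") simp_all
        then show ?thesis by (intro generate.incl) (auto simp: Ks_def)
      qed
      have "q \<in> Q \<Longrightarrow> set w \<subseteq> X \<times> UNIV \<Longrightarrow> set (weights q w) \<subseteq> generate G (\<Union>(set Ks))" for q w
        by (induction w arbitrary: q) (auto simp: wt step_Q)
      then have "\<one> \<otimes> word_value G (nf h) \<otimes> inv (foldl step \<one> (nf h)) \<in> generate G (\<Union>(set Ks))"
        using one_Q hc by (intro word_value_mem_subgroup generate_is_subgroup UG) auto
      then show "h \<in> generate G (\<Union>(set Ks))" using hc eh by simp
    qed
    then have "generate G (\<Union>(set Ks)) = H" using generate_subgroup_incl[OF UH H] by blast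
    then show "generate (G\<lparr>carrier := H\<rparr>) (\<Union>(set Ks)) = carrier (G\<lparr>carrier := H\<rparr>)"
      using generate_consistent[OF UH H] by simp
  qed
  then show ?thesis by (simp add: H_def Ks_def)
qed

text \<open>The vertices represent all cosets: if the path of \<open>g\<close> ends at \<open>q\<close>, following it by the tree path
  back to \<open>\<one>\<close> gives a closed path with value \<open>g q\<inverse>\<close>.\<close>

lemma loops_finite_index:
  assumes "finite Q"
  shows "finite_index G (loops (carrier G))"
proof (rule finite_indexI[OF assms Q_subset])
  show "subgroup (loops (carrier G)) G" by (rule loops_subgroup) simp
  fix g assume g: "g \<in> carrier G"
  define q where "q = foldl step \<one> (nf g)"
  have q: "q \<in> Q" unfolding q_def using one_Q nf_letters[OF g] by (rule end_Q)
  obtain w where w: "set w \<subseteq> X \<times> UNIV" "foldl step \<one> w = q" "word_value G w = q"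
    using tree_word[OF q] by blast
  have all: "q \<in> Q \<Longrightarrow> set w \<subseteq> X \<times> UNIV \<Longrightarrow> set (weights q w) \<subseteq> carrier G" for q w
    by (induction w arbitrary: q) (auto simp: weight_closed step_Q)
  have l: "set (nf g @ inverse_word w) \<subseteq> X \<times> UNIV"
    using nf_letters[OF g] inverse_word_letters[of w X] w(1) by simp
  have "word_value G (nf g @ inverse_word w) \<in> loops (carrier G)"
    using l end_inverse_word[OF one_Q w(1)] w(2) all[OF one_Q l]
    by (intro loopsI) (simp_all add: q_def)
  also have "word_value G (nf g @ inverse_word w) = g \<otimes> inv q"
    using g w l by (simp add: word_value_append word_value_inverse)
  finally show "\<exists>q\<in>Q. g \<otimes> inv q \<in> loops (carrier G)" using q by blast
qed

end

section \<open>Marshall Hall's theorem\<close>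

lemma extend_to_permutation:
  assumes "finite Q" "D \<subseteq> Q" "inj_on f D" "f ` D \<subseteq> Q"
  shows "\<exists>\<sigma>. bij_betw \<sigma> Q Q \<and> (\<forall>q\<in>D. \<sigma> q = f q)"
proof -
  have D: "finite D" using assms(1,2) by (rule finite_subset[rotated])
  have "card (Q - D) = card (Q - f ` D)"
    using assms D by (simp add: card_Diff_subset card_image)
  then obtain h where h: "bij_betw h (Q - D) (Q - f ` D)"
    using assms(1) finite_same_card_bij by blast
  define \<sigma> where "\<sigma> q = (if q \<in> D then f q else h q)" for q
  have "bij_betw \<sigma> D (f ` D)"
    using assms(3) by (auto simp: \<sigma>_def bij_betw_def inj_on_def)
  moreover have "bij_betw \<sigma> (Q - D) (Q - f ` D)"
    using h by (rule bij_betw_cong[THEN iffD1, rotated]) (simp add: \<sigma>_def)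
  ultimately have "bij_betw \<sigma> (D \<union> (Q - D)) (f ` D \<union> (Q - f ` D))"
    by (rule bij_betw_combine) blast
  then have "bij_betw \<sigma> Q Q" using assms(2,4) by (simp add: Un_absorb1)
  then show ?thesis by (intro exI[of _ \<sigma>]) (simp add: \<sigma>_def)
qed

context free_group
begin

text \<open>The finite vertex sets of connected subgraphs of the Cayley graph that contain \<open>\<one>\<close>.\<close>

inductive connected_set :: "'a set \<Rightarrow> bool" where
  base: "connected_set {\<one>}"
| grow: "connected_set P \<Longrightarrow> q \<in> P \<Longrightarrow> p \<in> X \<times> UNIV \<Longrightarrow>
    connected_set (insert (q \<otimes> letter_value G p) P)"

lemma connected_set_finite: "connected_set P \<Longrightarrow> finite P"
  by (induction rule: connected_set.induct) auto

lemma connected_set_closed: "connected_set P \<Longrightarrow> P \<subseteq> carrier G"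
  by (induction rule: connected_set.induct) auto

lemma connected_set_one: "connected_set P \<Longrightarrow> \<one> \<in> P"
  by (induction rule: connected_set.induct) auto

lemma connected_set_word:
  "connected_set P \<Longrightarrow> q \<in> P \<Longrightarrow>
    \<exists>w. set w \<subseteq> X \<times> UNIV \<and> word_value G w = q \<and> (\<forall>u v. w = u @ v \<longrightarrow> word_value G u \<in> P)"
proof (induction arbitrary: q rule: connected_set.induct)
  case base
  then show ?case by (intro exI[of _ "[]"]) simp
next
  case (grow P r p)
  show ?case
  proof (cases "q \<in> P")
    case True
    then show ?thesis using grow.IH by (meson insertCI)
  next
    case False
    then have q: "q = r \<otimes> letter_value G p" using grow.prems by simp
    obtain w where w: "set w \<subseteq> X \<times> UNIV" "word_value G w = r"
      "\<And>u v. w = u @ v \<Longrightarrow> word_value G u \<in> P"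
      using grow.IH[OF grow.hyps(2)] by blast
    have val: "word_value G (w @ [p]) = q"
      using w q grow.hyps(3) by (simp add: word_value_append)
    have "word_value G u \<in> insert (r \<otimes> letter_value G p) P" if "w @ [p] = u @ v" for u v
    proof (cases v rule: rev_cases)
      case Nil
      then show ?thesis using that val q by simp
    next
      case (snoc v' p')
      then show ?thesis using that w(3) by simp
    qed
    then show ?thesis using w(1) grow.hyps(3) val by (intro exI[of _ "w @ [p]"]) simp
  qed
qed

lemma connected_set_add_prefixes:
  "connected_set P \<Longrightarrow> set w \<subseteq> X \<times> UNIV \<Longrightarrow>
    \<exists>P'. connected_set P' \<and> P \<subseteq> P' \<and> (\<forall>u v. w = u @ v \<longrightarrow> word_value G u \<in> P')"
proof (induction w rule: rev_induct)
  case Nil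
  then show ?case using connected_set_one by (intro exI[of _ P]) simp
next
  case (snoc p w)
  then have l: "set w \<subseteq> X \<times> UNIV" "p \<in> X \<times> UNIV" by auto
  obtain P' where P': "connected_set P'" "P \<subseteq> P'" "\<And>u v. w = u @ v \<Longrightarrow> word_value G u \<in> P'"
    using snoc l by blast
  define P'' where "P'' = insert (word_value G w \<otimes> letter_value G p) P'"
  have "connected_set P''" unfolding P''_def using P' l by (intro connected_set.grow) auto
  moreover have "word_value G u \<in> P''" if "w @ [p] = u @ v" for u v
  proof (cases v rule: rev_cases)
    case Nil
    then have "u = w @ [p]" using that by simp
    then show ?thesis using l by (simp add: P''_def word_value_append)
  next
    case (snoc v' p')
    then show ?thesis using that P'(3) by (simp add: P''_def)
  qed
  ultimately show ?case using P'(2) by (intro exI[of _ P'']) (auto simp: P''_def)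
qed

lemma connected_set_prefixes:
  assumes "finite W" "\<And>w. w \<in> W \<Longrightarrow> set w \<subseteq> X \<times> UNIV"
  shows "\<exists>P. connected_set P \<and> (\<forall>w\<in>W. \<forall>u v. w = u @ v \<longrightarrow> word_value G u \<in> P)"
  using assms
proof (induction W rule: finite_induct)
  case empty
  then show ?case using connected_set.base by blast
next
  case (insert w W)
  then obtain P where P: "connected_set P" "\<forall>w\<in>W. \<forall>u v. w = u @ v \<longrightarrow> word_value G u \<in> P"
    by auto
  have wl: "set w \<subseteq> X \<times> UNIV" using insert.prems by simp
  obtain P' where P': "connected_set P'" "P \<subseteq> P'"
    "\<forall>u v. w = u @ v \<longrightarrow> word_value G u \<in> P'"
    using connected_set_add_prefixes[OF P(1) wl] by blast
  have "\<forall>u v. w' = u @ v \<longrightarrow> word_value G u \<in> P'" if "w' \<in> insert w W" for w'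
  proof (cases "w' = w")
    case True then show ?thesis using P'(3) by blast
  next
    case False
    then have "w' \<in> W" using that by simp
    then show ?thesis using P(2) P'(2) by (simp add: subset_iff)
  qed
  then show ?case using P'(1) by blast
qed

text \<open>While \<open>P\<close> grows by a neighbour \<open>g p\<close> of \<open>g\<close>, the set \<open>Q\<close> grows by the corresponding neighbour
  \<open>q p\<close> of the representative \<open>q\<close> of \<open>g\<close>, unless the coset of \<open>g p\<close> is represented already. So \<open>Q\<close>
  stays connected.\<close>

lemma connected_transversal:
  assumes K: "subgroup K G" and "connected_set P"
  shows "\<exists>Q. connected_set Q \<and> (\<forall>g\<in>P. \<exists>q\<in>Q. g \<otimes> inv q \<in> K) \<and>
    (\<forall>q\<in>Q. \<forall>q'\<in>Q. q \<otimes> inv q' \<in> K \<longrightarrow> q = q')"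
  using assms(2)
proof (induction rule: connected_set.induct)
  case base
  then show ?case using connected_set.base subgroup.one_closed[OF K] by (intro exI[of _ "{\<one>}"]) simp
next
  case (grow P g p)
  obtain Q where Q: "connected_set Q" "\<forall>g\<in>P. \<exists>q\<in>Q. g \<otimes> inv q \<in> K"
    "\<forall>q\<in>Q. \<forall>q'\<in>Q. q \<otimes> inv q' \<in> K \<longrightarrow> q = q'"
    using grow.IH by blast
  obtain q where q: "q \<in> Q" "g \<otimes> inv q \<in> K" using Q(2) grow.hyps(2) by blast
  define h where "h = g \<otimes> letter_value G p"
  define r where "r = q \<otimes> letter_value G p"
  have c: "g \<in> carrier G" "q \<in> carrier G" "letter_value G p \<in> carrier G"
    using connected_set_closed grow.hyps Q(1) q(1) by auto
  have hr: "h \<otimes> inv r = g \<otimes> inv q"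
  proof -
    have "letter_value G p \<otimes> (inv (letter_value G p) \<otimes> inv q) = inv q"
      using c by (simp add: m_assoc[symmetric])
    then show ?thesis unfolding h_def r_def using c by (simp add: inv_mult_group m_assoc)
  qed
  show ?case
  proof (cases "\<exists>q'\<in>Q. h \<otimes> inv q' \<in> K")
    case True
    then show ?thesis using Q unfolding h_def by (intro exI[of _ Q]) blast
  next
    case False
    have rc: "r \<in> carrier G" "h \<in> carrier G" using c by (auto simp: r_def h_def)
    have new: "r \<otimes> inv q' \<notin> K" if "q' \<in> Q" for q'
    proof
      assume *: "r \<otimes> inv q' \<in> K"
      have q'c: "q' \<in> carrier G" using that connected_set_closed[OF Q(1)] by blast
      have "h \<otimes> inv r \<otimes> (r \<otimes> inv q') \<in> K" using * hr q(2) subgroup.m_closed[OF K] by simp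
      moreover have "h \<otimes> inv r \<otimes> (r \<otimes> inv q') = h \<otimes> inv q'"
        using rc q'c by (metis inv_closed inv_solve_right m_assoc m_closed)
      ultimately show False using False that by simp
    qed
    have new': "q' \<otimes> inv r \<notin> K" if "q' \<in> Q" for q'
    proof
      assume *: "q' \<otimes> inv r \<in> K"
      have q'c: "q' \<in> carrier G" using that connected_set_closed[OF Q(1)] by blast
      have "inv (q' \<otimes> inv r) \<in> K" using * subgroup.m_inv_closed[OF K] by simp
      then show False using new[OF that] q'c rc by (simp add: inv_mult_group)
    qed
    have "connected_set (insert r Q)" unfolding r_def using Q(1) q(1) grow.hyps(3) by (rule connected_set.grow)
    moreover have "\<forall>g\<in>insert h P. \<exists>q\<in>insert r Q. g \<otimes> inv q \<in> K"
      using Q(2) hr q(2) by auto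
    moreover have "\<forall>q\<in>insert r Q. \<forall>q'\<in>insert r Q. q \<otimes> inv q' \<in> K \<longrightarrow> q = q'"
      using Q(3) new new' by blast
    ultimately show ?thesis unfolding h_def by blast
  qed
qed

lemma subgroup_translate:
  assumes K: "subgroup K G" and c: "a \<in> carrier G" "b \<in> carrier G" "x \<in> carrier G" "y \<in> carrier G"
    and mem: "a \<otimes> inv b \<in> K" "a \<otimes> x \<otimes> inv y \<in> K"
  shows "b \<otimes> x \<otimes> inv y \<in> K"
proof -
  have "inv (a \<otimes> inv b) \<otimes> (a \<otimes> x \<otimes> inv y) \<in> K"
    using mem by (simp add: subgroup.m_closed[OF K] subgroup.m_inv_closed[OF K])
  moreover have "inv a \<otimes> (a \<otimes> (x \<otimes> inv y)) = x \<otimes> inv y"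
    using c by (simp add: m_assoc[symmetric])
  then have "inv (a \<otimes> inv b) \<otimes> (a \<otimes> x \<otimes> inv y) = b \<otimes> x \<otimes> inv y"
    using c by (simp add: inv_mult_group m_assoc)
  ultimately show ?thesis using c by simp
qed

text \<open>Let \<open>P\<close> contain all prefixes of finitely many generators of \<open>K\<close>, and let \<open>Q\<close> be a connected set of
  representatives of the cosets \<open>K g\<close> with \<open>g \<in> P\<close>. Right multiplication by a basis element induces
  an injective map from a part of \<open>Q\<close> to \<open>Q\<close>; since \<open>Q\<close> is finite, it extends to a permutation of
  \<open>Q\<close>. The permutations make \<open>Q\<close> a finite covering graph, in which the edges that come from right
  multiplication are those with weight in \<open>K\<close>. The paths of the generators run along such edges, so the
  closed paths along such edges have exactly the elements of \<open>K\<close> as values; the remaining edges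
  contribute a free complement.\<close>

theorem marshall_hall:
  assumes K: "subgroup K G" and fg: "finitely_generated G K"
  shows "\<exists>H B. subgroup H G \<and> finite_index G H \<and> free_factorization (G\<lparr>carrier := H\<rparr>) [K, B]"
proof -
  obtain A where A: "finite A" "A \<subseteq> K" "generate G A = K"
    using fg unfolding finitely_generated_def by blast
  have KG: "K \<subseteq> carrier G" using K by (rule subgroup.subset)
  note K1 = subgroup.one_closed[OF K]
  have AG: "A \<subseteq> carrier G" using A(2) KG by blast
  have "\<exists>P. connected_set P \<and> (\<forall>w\<in>nf ` A. \<forall>u v. w = u @ v \<longrightarrow> word_value G u \<in> P)"
  proof (rule connected_set_prefixes)
    show "finite (nf ` A)" using A(1) by simp
    show "set w \<subseteq> X \<times> UNIV" if w: "w \<in> nf ` A" for w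
    proof -
      obtain a where "a \<in> carrier G" "w = nf a" using w AG by blast
      then show ?thesis using nf_letters by simp
    qed
  qed
  then obtain P where P: "connected_set P" "\<And>a u v. a \<in> A \<Longrightarrow> nf a = u @ v \<Longrightarrow> word_value G u \<in> P"
    by (metis imageI)
  obtain Q where Q: "connected_set Q" "\<And>g. g \<in> P \<Longrightarrow> \<exists>q\<in>Q. g \<otimes> inv q \<in> K"
    and uniq: "\<And>q q'. q \<in> Q \<Longrightarrow> q' \<in> Q \<Longrightarrow> q \<otimes> inv q' \<in> K \<Longrightarrow> q = q'"
    using connected_transversal[OF K P(1)] by blast
  have QG: "Q \<subseteq> carrier G" and Qfin: "finite Q" and Q1: "\<one> \<in> Q"
    using connected_set_closed connected_set_finite connected_set_one Q(1) by auto
  have Qc: "q \<in> carrier G" if "q \<in> Q" for q using that QG by blast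
  have "\<exists>\<sigma>. bij_betw \<sigma> Q Q \<and> (\<forall>q\<in>Q. \<forall>q'\<in>Q. q \<otimes> x \<otimes> inv q' \<in> K \<longrightarrow> \<sigma> q = q')" if "x \<in> X" for x
  proof -
    have xc: "x \<in> carrier G" using that basis by (auto simp: free_basis_def)
    define D where "D = {q \<in> Q. \<exists>q'\<in>Q. q \<otimes> x \<otimes> inv q' \<in> K}"
    define f where "f q = (SOME q'. q' \<in> Q \<and> q \<otimes> x \<otimes> inv q' \<in> K)" for q
    have f: "f q \<in> Q \<and> q \<otimes> x \<otimes> inv (f q) \<in> K" if "q \<in> D" for q
      using that someI_ex[of "\<lambda>q'. q' \<in> Q \<and> q \<otimes> x \<otimes> inv q' \<in> K"] unfolding D_def f_def by blast
    have feq: "f q = q'" if "q \<in> D" "q' \<in> Q" "q \<otimes> x \<otimes> inv q' \<in> K" for q q'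
    proof (rule uniq)
      have qc: "q \<in> carrier G" "f q \<in> carrier G" "q' \<in> carrier G"
        using that f QG by (auto simp: D_def)
      show "f q \<otimes> inv q' \<in> K"
        using subgroup_translate[OF K, of "q \<otimes> x" "f q" \<one> q'] qc xc f that by simp
    qed (use f that in auto)
    have "inj_on f D"
    proof (rule inj_onI)
      fix q r assume qr: "q \<in> D" "r \<in> D" "f q = f r"
      have c: "q \<in> carrier G" "r \<in> carrier G" "f q \<in> carrier G"
        using qr f QG by (auto simp: D_def)
      have "inv (r \<otimes> x \<otimes> inv (f q)) \<in> K" using f[OF qr(2)] qr(3) subgroup.m_inv_closed[OF K] by simp
      then have "q \<otimes> x \<otimes> inv (f q) \<otimes> inv (r \<otimes> x \<otimes> inv (f q)) \<in> K"
        using f[OF qr(1)] subgroup.m_closed[OF K] by blast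
      also have "q \<otimes> x \<otimes> inv (f q) \<otimes> inv (r \<otimes> x \<otimes> inv (f q)) = q \<otimes> inv r"
      proof -
        have "inv (f q) \<otimes> (f q \<otimes> (inv x \<otimes> inv r)) = inv x \<otimes> inv r"
          "x \<otimes> (inv x \<otimes> inv r) = inv r"
          using c xc by (simp_all add: m_assoc[symmetric])
        then show ?thesis using c xc by (simp add: inv_mult_group m_assoc)
      qed
      finally show "q = r" using uniq qr by (auto simp: D_def)
    qed
    moreover have "D \<subseteq> Q" "f ` D \<subseteq> Q" using f by (auto simp: D_def)
    ultimately obtain \<sigma> where "bij_betw \<sigma> Q Q" "\<forall>q\<in>D. \<sigma> q = f q"
      using extend_to_permutation[OF Qfin] by blast
    then show ?thesis using feq unfolding D_def by (intro exI[of _ \<sigma>]) auto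
  qed
  then obtain \<sigma> where \<sigma>: "\<And>x. x \<in> X \<Longrightarrow> bij_betw (\<sigma> x) Q Q"
    "\<And>x q q'. x \<in> X \<Longrightarrow> q \<in> Q \<Longrightarrow> q' \<in> Q \<Longrightarrow> q \<otimes> x \<otimes> inv q' \<in> K \<Longrightarrow> \<sigma> x q = q'"
    by metis
  define step where "step q p = (if snd p then \<sigma> (fst p) q else inv_into Q (\<sigma> (fst p)) q)" for q and p :: "'a letter"
  \<comment> \<open>distinct elements of \<open>Q\<close> lie in distinct cosets, so all edges that come from the action on
    cosets have their endpoint in \<open>Q\<close> forced, tree edges among them\<close>
  have stepI: "step q p = q'"
    if q: "q \<in> Q" "q' \<in> Q" and p: "p \<in> X \<times> UNIV" and mem: "q \<otimes> letter_value G p \<otimes> inv q' \<in> K" for q q' p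
  proof (cases "snd p")
    case True
    then show ?thesis using \<sigma>(2)[of "fst p" q q'] q p mem by (auto simp: step_def letter_value_def)
  next
    case False
    have x: "fst p \<in> X" using p by auto
    then have xc: "fst p \<in> carrier G" using basis by (auto simp: free_basis_def)
    have "inv (q \<otimes> inv (fst p) \<otimes> inv q') \<in> K"
      using mem False subgroup.m_inv_closed[OF K] by (simp add: letter_value_def)
    then have "q' \<otimes> fst p \<otimes> inv q \<in> K" using q Qc xc by (simp add: inv_mult_group m_assoc)
    then have "\<sigma> (fst p) q' = q" using \<sigma>(2) x q by blast
    then show ?thesis using False \<sigma>(1)[OF x] q by (auto simp: step_def bij_betw_def)
  qed
  have prefix_end: "foldl step \<one> u = word_value G u"
    if "set u \<subseteq> X \<times> UNIV" "\<And>v v'. u = v @ v' \<Longrightarrow> word_value G v \<in> Q" for u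
    using that
  proof (induction u rule: rev_induct)
    case (snoc p u)
    have l: "set u \<subseteq> X \<times> UNIV" "p \<in> X \<times> UNIV" using snoc.prems(1) by auto
    have "foldl step \<one> u = word_value G u"
      using l(1) snoc.prems(2)[of _ "_ @ [p]"] by (intro snoc.IH) simp_all
    moreover have "word_value G u \<in> Q" "word_value G (u @ [p]) \<in> Q"
      using snoc.prems(2)[of u "[p]"] snoc.prems(2)[of "u @ [p]" "[]"] by simp_all
    ultimately have u: "foldl step \<one> u = word_value G u" "word_value G u \<in> Q"
      "word_value G (u @ [p]) \<in> Q" .
    have "step (word_value G u) p = word_value G (u @ [p])"
      using u l K1 Qc[OF u(3)] by (intro stepI) (auto simp: word_value_append)
    then show ?case using u by simp
  qed simp
  interpret pointed_covering G X Q step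
  proof
    show "Q \<subseteq> carrier G" "\<one> \<in> Q" using QG Q1 .
    show "step q p \<in> Q" if "q \<in> Q" "p \<in> X \<times> UNIV" for q p
      using that \<sigma>(1)[of "fst p"] bij_betw_inv_into[OF \<sigma>(1)[of "fst p"]]
      by (auto simp: step_def bij_betw_apply)
    show "step (step q p) (flip p) = q" if "q \<in> Q" "p \<in> X \<times> UNIV" for q p
      using that \<sigma>(1)[of "fst p"]
      by (auto simp: step_def flip_def bij_betw_inv_into_left bij_betw_inv_into_right)
    show "\<exists>w. set w \<subseteq> X \<times> UNIV \<and> foldl step \<one> w = q \<and>
      (\<forall>u p v. w = u @ p # v \<longrightarrow> step (foldl step \<one> u) p = foldl step \<one> u \<otimes> letter_value G p)"
      if q: "q \<in> Q" for q
    proof -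
      obtain w where w: "set w \<subseteq> X \<times> UNIV" "word_value G w = q"
        "\<And>u v. w = u @ v \<Longrightarrow> word_value G u \<in> Q"
        using connected_set_word[OF Q(1) q] by blast
      have pre: "foldl step \<one> u = word_value G u" if "w = u @ v" for u v
        using w(1,3) that by (intro prefix_end) auto
      have "step (foldl step \<one> u) p = foldl step \<one> u \<otimes> letter_value G p" if "w = u @ p # v" for u p v
      proof -
        have "foldl step \<one> (u @ [p]) = word_value G (u @ [p])" "foldl step \<one> u = word_value G u"
          using pre[of "u @ [p]" v] pre[of u "p # v"] that by auto
        moreover have "set u \<subseteq> X \<times> UNIV" "p \<in> X \<times> UNIV" using w(1) that by auto
        ultimately show ?thesis by (simp add: word_value_append)
      qed
      then show ?thesis using w pre[of w "[]"] by auto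
    qed
  qed
  \<comment> \<open>the path of a generator visits the representatives of the cosets of its prefixes\<close>
  have "A \<subseteq> loops K"
  proof
    fix a assume a: "a \<in> A"
    then have ac: "a \<in> carrier G" and aK: "a \<in> K" using AG A(2) by auto
    have "word_value G u \<otimes> inv (foldl step \<one> u) \<in> K \<and> set (weights \<one> u) \<subseteq> K"
      if "nf a = u @ v" for u v
      using that
    proof (induction u arbitrary: v rule: rev_induct)
      case Nil then show ?case using K1 by simp
    next
      case (snoc p u)
      have l: "set u \<subseteq> X \<times> UNIV" "p \<in> X \<times> UNIV" using nf_letters[OF ac] snoc.prems by auto
      define q where "q = foldl step \<one> u"
      have q: "q \<in> Q" unfolding q_def using one_Q l(1) by (rule end_Q)
      have IH: "word_value G u \<otimes> inv q \<in> K" "set (weights \<one> u) \<subseteq> K"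
        using snoc.IH[of "p # v"] snoc.prems by (simp_all add: q_def)
      have "word_value G (u @ [p]) \<in> P" using P(2)[OF a snoc.prems] .
      then obtain q' where q': "q' \<in> Q" "word_value G (u @ [p]) \<otimes> inv q' \<in> K" using Q(2) by blast
      have "q \<otimes> letter_value G p \<otimes> inv q' \<in> K"
        using subgroup_translate[OF K, of "word_value G u" q "letter_value G p" q'] q q' IH(1) l Qc
        by (simp add: word_value_append)
      then have "step q p = q'" "weight q p \<in> K"
        using stepI[OF q q'(1) l(2)] by (auto simp: weight_def)
      then show ?case using q' IH(2) by (simp add: weights_append q_def)
    qed
    from this[of "nf a" "[]"]
    have aq: "a \<otimes> inv (foldl step \<one> (nf a)) \<in> K" and wt: "set (weights \<one> (nf a)) \<subseteq> K"
      using ac by simp_all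
    have e: "foldl step \<one> (nf a) \<in> Q" using one_Q nf_letters[OF ac] by (rule end_Q)
    have "\<one> \<otimes> \<one> \<otimes> inv (foldl step \<one> (nf a)) \<in> K"
      using subgroup_translate[OF K, of a \<one> \<one> "foldl step \<one> (nf a)"] aq aK ac Qc[OF e] by simp
    then have "foldl step \<one> (nf a) = \<one>" using uniq[OF Q1 e] by simp
    then show "a \<in> loops K" using ac wt by (simp add: loops_def)
  qed
  then have "K \<subseteq> loops K"
    using generate_subgroup_incl[OF _ loops_subgroup] A(3) subgroup.m_inv_closed[OF K] by blast
  moreover have "loops K \<subseteq> K"
  proof
    fix g assume "g \<in> loops K"
    then show "g \<in> K"
      using word_value_mem_subgroup[OF K one_Q, of "nf g"] by (auto simp: loops_def)
  qed
  ultimately have LK: "loops K = K" by blast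
  have "subgroup (loops (carrier G)) G" by (rule loops_subgroup) simp
  moreover have "finite_index G (loops (carrier G))" using Qfin by (rule loops_finite_index)
  moreover have "free_factorization (G\<lparr>carrier := loops (carrier G)\<rparr>)
      [K, loops (insert \<one> (carrier G - K))]"
    using loops_free_factorization[OF K] LK by simp
  ultimately show ?thesis by blast
qed

end

section \<open>Boundary points and lines\<close>

context free_group
begin

lemma take_prefix_word: "m \<le> n \<Longrightarrow> take m (prefix_word n \<xi>) = prefix_word m \<xi>"
  by (simp add: prefix_word_def take_map)

lemma prefix_word_reduced: "\<xi> \<in> boundary X \<Longrightarrow> prefix_word n \<xi> \<in> reduced_words X"
  by (auto simp: boundary_def prefix_word_def reduced_words_def successively_conv_nth)

lemma prefix_words_eqD:
  assumes "\<And>m. prefix_word m \<xi> = prefix_word m \<eta>"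
  shows "\<xi> = \<eta>"
proof
  fix m
  have "prefix_word (Suc m) \<xi> ! m = prefix_word (Suc m) \<eta> ! m" using assms by simp
  then show "\<xi> m = \<eta> m" by (simp add: prefix_word_def nth_append)
qed

lemma prefixes_converge:
  assumes "\<xi> \<in> boundary X"
  shows "converges_to_end G X (\<lambda>n. word_value G (prefix_word n \<xi>)) \<xi>"
  unfolding converges_to_end_def
  using nf_word_value[OF prefix_word_reduced[OF assms]] take_prefix_word by metis

lemma converges_to_end_unique:
  assumes "converges_to_end G X a \<xi>" "converges_to_end G X a \<eta>"
  shows "\<xi> = \<eta>"
proof (rule prefix_words_eqD)
  fix m
  obtain N N' where "\<forall>n\<ge>N. take m (nf (a n)) = prefix_word m \<xi>"
    "\<forall>n\<ge>N'. take m (nf (a n)) = prefix_word m \<eta>"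
    using assms unfolding converges_to_end_def by meson
  then show "prefix_word m \<xi> = prefix_word m \<eta>" by (metis max.cobounded1 max.cobounded2)
qed

lemma boundary_act_one:
  assumes \<xi>: "\<xi> \<in> boundary X"
  shows "boundary_act G X \<one> \<xi> = \<xi>"
proof -
  have "\<one> \<otimes> word_value G (prefix_word n \<xi>) = word_value G (prefix_word n \<xi>)" for n
    using reduced_word_letters[OF prefix_word_reduced[OF \<xi>]] by simp
  then show ?thesis
    unfolding boundary_act_def
    using prefixes_converge[OF \<xi>] converges_to_end_unique \<xi>
    by (intro the_equality) auto
qed

text \<open>The class of a lift contains the lift because \<open>\<one>\<close> acts trivially, and \<open>X\<close> itself is a basis that
  shows every boundary point to belong to the boundary of the full subgroup.\<close>

lemma carrier_carries_line:
  assumes "l \<in> lines G X"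
  shows "carries G X (carrier G) l"
proof -
  obtain L where L: "L \<in> line_lifts X" and l: "l = same_line G X `` {L}"
    using assms unfolding lines_def by (rule quotientE)
  have LX: "L \<subseteq> boundary X" using L by (auto simp: line_lifts_def)
  have "L = boundary_act G X \<one> ` L" using LX by (force simp: boundary_act_one)
  then have "(L, L) \<in> same_line G X" using L unfolding same_line_def by blast
  then have "L \<in> l" using l by simp
  moreover have "boundary X \<subseteq> subgroup_boundary G X (carrier G)"
    unfolding subgroup_boundary_def using basis prefixes_converge by auto
  ultimately show ?thesis unfolding carries_def using LX by blast
qed

end

section \<open>Conjugates\<close>

lemma (in group) conjugate_mult:
  assumes "g \<in> carrier G" "x \<in> carrier G" "y \<in> carrier G"
  shows "g \<otimes> x \<otimes> inv g \<otimes> (g \<otimes> y \<otimes> inv g) = g \<otimes> (x \<otimes> y) \<otimes> inv g"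
proof -
  have "inv g \<otimes> (g \<otimes> (y \<otimes> inv g)) = y \<otimes> inv g" using assms by (simp add: m_assoc[symmetric])
  then show ?thesis using assms by (simp add: m_assoc)
qed

lemma (in group) conjugate_subgroup:
  assumes K: "subgroup K G" and g: "g \<in> carrier G"
  shows "subgroup ((\<lambda>x. g \<otimes> x \<otimes> inv g) ` K) G"
proof -
  have "group_hom G G (\<lambda>x. g \<otimes> x \<otimes> inv g)"
  proof (intro group_hom.intro is_group group_hom_axioms.intro homI)
    fix x y assume "x \<in> carrier G" "y \<in> carrier G"
    then show "g \<otimes> (x \<otimes> y) \<otimes> inv g = g \<otimes> x \<otimes> inv g \<otimes> (g \<otimes> y \<otimes> inv g)"
      using g by (simp add: conjugate_mult)
  qed (use g in simp)
  then show ?thesis using K by (rule group_hom.subgroup_img_is_subgroup)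
qed

lemma (in group) conjugate_finitely_generated:
  assumes K: "subgroup K G" and fg: "finitely_generated G K" and g: "g \<in> carrier G"
  shows "finitely_generated G ((\<lambda>x. g \<otimes> x \<otimes> inv g) ` K)" (is "finitely_generated G (?c ` K)")
proof -
  obtain A where A: "finite A" "A \<subseteq> K" "generate G A = K"
    using fg unfolding finitely_generated_def by blast
  have AG: "A \<subseteq> carrier G" using A(2) subgroup.subset[OF K] by blast
  have "?c x \<in> generate G (?c ` A)" if "x \<in> generate G A" for x
    using that
  proof (induction x rule: generate.induct)
    case one then show ?case using g by (simp add: generate.one)
  next
    case (incl h) then show ?case by (intro generate.incl) simp
  next
    case (inv h)
    have "inv (?c h) \<in> generate G (?c ` A)" using inv by (intro generate.inv) simp
    then show ?case using g inv AG by (simp add: inv_mult_group m_assoc subset_iff)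
  next
    case (eng h1 h2)
    have "h1 \<in> carrier G" "h2 \<in> carrier G" using eng.hyps generate_in_carrier[OF AG] by auto
    then have "?c (h1 \<otimes> h2) = ?c h1 \<otimes> ?c h2" using conjugate_mult g by simp
    then show ?case using eng.IH by (simp add: generate.eng)
  qed
  then have "?c ` K \<subseteq> generate G (?c ` A)" using A(3) by blast
  moreover have "generate G (?c ` A) \<subseteq> ?c ` K"
    using A(2) by (intro generate_subgroup_incl conjugate_subgroup K g) blast
  ultimately have "generate G (?c ` A) = ?c ` K" by blast
  then show ?thesis unfolding finitely_generated_def using A(1,2) by (metis finite_imageI image_mono)
qed

lemma (in group) conjugate_power_mem:
  assumes K: "subgroup K G" and g: "g \<in> carrier G" and c: "c \<in> carrier G"
    and mem: "(g \<otimes> c \<otimes> inv g) [^] (k::nat) \<in> (\<lambda>x. g \<otimes> x \<otimes> inv g) ` K"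
  shows "c [^] k \<in> K"
proof -
  have "(g \<otimes> c \<otimes> inv g) [^] n = g \<otimes> c [^] n \<otimes> inv g" for n :: nat
    using g c by (induction n) (simp_all add: conjugate_mult)
  then obtain x where x: "x \<in> K" "g \<otimes> c [^] k \<otimes> inv g = g \<otimes> x \<otimes> inv g" using mem by auto
  moreover have "x \<in> carrier G" using K x(1) by (rule subgroup.mem_carrier)
  ultimately have "c [^] k = x" using g c by simp
  then show ?thesis using x by simp
qed

section \<open>Minimally filling sets of lines\<close>

text \<open>Ping-pong, with the empty set for the trivial factor.\<close>

lemma (in group) trivial_free_factorization:
  "free_factorization G [carrier G, {\<one>}]"
proof (rule ping_pong[where P = "\<lambda>i. if i = 0 then carrier G - {\<one>} else {}"])
  show "\<forall>K\<in>set [carrier G, {\<one>}]. subgroup K G"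
    using subgroup_self triv_subgroup by simp
  have "generate G (carrier G) = carrier G"
    using generate_incl[of "carrier G"] generate.incl[of _ "carrier G" G] by (intro equalityI subsetI) auto
  then show "generate G (\<Union>(set [carrier G, {\<one>}])) = carrier G"
    by (simp add: insert_absorb)
  fix i g x
  assume "i < length [carrier G, {\<one>}]" "g \<in> [carrier G, {\<one>}] ! i" "g \<noteq> \<one>" "x \<in> carrier G"
    "x = \<one> \<or> (\<exists>j<length [carrier G, {\<one>}]. j \<noteq> i \<and> x \<in> (if j = 0 then carrier G - {\<one>} else {}))"
  then show "g \<otimes> x \<in> (if i = 0 then carrier G - {\<one>} else {})"
    by (cases i) (auto split: if_splits)
qed auto

text \<open>A trivial factor is handled by a basis element, which has infinite order; any other proper
  factor by its normal forms.\<close>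

lemma (in free_group) factor_of_finite_index_avoids_powers:
  assumes H: "subgroup H G" "finite_index G H" and "X \<noteq> {}"
    and ff: "free_factorization (G\<lparr>carrier := H\<rparr>) Ks" and K: "K \<in> set Ks" "K \<noteq> H"
  shows "\<exists>c\<in>carrier G. \<forall>k>0. c [^] (k::nat) \<notin> K"
proof (cases "K = {\<one>}")
  case True
  obtain x where x: "x \<in> X" using \<open>X \<noteq> {}\<close> by blast
  then have "x \<in> carrier G" using basis by (auto simp: free_basis_def)
  then show ?thesis using True basis_element_infinite_order[OF x] by blast
next
  case False
  interpret H: group "G\<lparr>carrier := H\<rparr>" using H(1) by (rule subgroup_imp_group)
  obtain c where "c \<in> H" "\<And>k::nat. k > 0 \<Longrightarrow> c [^]\<^bsub>G\<lparr>carrier := H\<rparr>\<^esub> k \<notin> K"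
    using H.proper_free_factor_avoids_powers[OF ff K(1)] K(2) False by auto
  then show ?thesis using subgroup.subset[OF H(1)] by (auto simp: nat_pow_consistent[symmetric])
qed

lemma (in free_group) factor_of_finite_index_finitely_generated:
  assumes "finite X" and H: "subgroup H G" "finite_index G H"
    and ff: "free_factorization (G\<lparr>carrier := H\<rparr>) Ks" and K: "K \<in> set Ks"
  shows "subgroup K G" "finitely_generated G K"
proof -
  interpret H: group "G\<lparr>carrier := H\<rparr>" using H(1) by (rule subgroup_imp_group)
  have KH: "subgroup K (G\<lparr>carrier := H\<rparr>)" using ff K by (simp add: free_factorization_def)
  show "subgroup K G" using H(1) KH by (rule incl_subgroup)
  have fgc: "finitely_generated (G\<lparr>carrier := H\<rparr>) L \<longleftrightarrow> finitely_generated G L" if "L \<subseteq> H" for L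
    using that generate_consistent[OF _ H(1)] unfolding finitely_generated_def
    by (metis subset_trans)
  have "finitely_generated G H"
    using carrier_finitely_generated[OF assms(1)] H by (rule finite_index_finitely_generated)
  then have "finitely_generated (G\<lparr>carrier := H\<rparr>) (carrier (G\<lparr>carrier := H\<rparr>))" using fgc by simp
  then have "finitely_generated (G\<lparr>carrier := H\<rparr>) K"
    using H.free_factor_finitely_generated[OF ff _ K] by blast
  then show "finitely_generated G K" using fgc subgroup.subset[OF KH] by simp
qed

lemma (in group) carrier_finite_index: "finite_index G (carrier G)"
  by (rule finite_indexI[of "{\<one>}"]) (auto intro: subgroup_self)

text \<open>A line of \<open>S\<close> is carried by a conjugate of a factor of any system that carries \<open>S\<close>. Both the
  factor and its conjugate are finitely generated, so by minimality the conjugate has finite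
  index, and then so has the factor; this forces the factor to be the whole group. Nonemptiness
  of \<open>S\<close> excludes the empty system.\<close>

lemma (in free_group) minimally_filling_filling:
  assumes fin: "finite X" and "X \<noteq> {}" and S: "S \<subseteq> lines G X" "S \<noteq> {}"
    and mf: "minimally_filling G X S"
  shows "filling G X S"
proof -
  let ?F = "{subgroup_conj_class G (carrier G)}"
  obtain x where x: "x \<in> X" using \<open>X \<noteq> {}\<close> by blast
  then have xc: "x \<in> carrier G" using basis by (auto simp: free_basis_def)
  have "x \<noteq> \<one>" using basis_element_infinite_order[OF x, of 1] xc by simp
  then have "carrier G \<noteq> {\<one>}" using xc by blast
  then have sys: "free_factor_system G ?F"
    unfolding free_factor_system_def using trivial_free_factorization
    by (intro exI[of _ "[carrier G]"] exI[of _ "{\<one>}"]) simp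
  have self: "carrier G \<in> subgroup_conj_class G (carrier G)"
  proof -
    have "(\<lambda>x. \<one> \<otimes> x \<otimes> inv \<one>) ` carrier G = carrier G" by simp
    then show ?thesis unfolding subgroup_conj_class_def using one_closed by blast
  qed
  then have car: "\<forall>l\<in>S. system_carries G X ?F l"
    unfolding system_carries_def using carrier_carries_line S(1) by blast
  have "system_le ?F \<F>" if \<F>: "free_factor_system G \<F>" "\<forall>l\<in>S. system_carries G X \<F> l" for \<F>
  proof -
    obtain Ks B where ff: "free_factorization G (Ks @ [B])"
      and \<F>_eq: "\<F> = subgroup_conj_class G ` set Ks"
      using \<F>(1) unfolding free_factor_system_def by blast
    obtain l where l: "l \<in> S" using S(2) by blast
    then obtain c L where c: "c \<in> \<F>" "L \<in> c" "carries G X L l"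
      using \<F>(2) unfolding system_carries_def by blast
    then obtain K where K: "K \<in> set Ks" "c = subgroup_conj_class G K" using \<F>_eq by blast
    then obtain g where g: "g \<in> carrier G" "L = (\<lambda>x. g \<otimes> x \<otimes> inv g) ` K"
      using c(2) unfolding subgroup_conj_class_def by blast
    have ff': "free_factorization (G\<lparr>carrier := carrier G\<rparr>) (Ks @ [B])" using ff by simp
    have K': "K \<in> set (Ks @ [B])" using K(1) by simp
    note fgK = factor_of_finite_index_finitely_generated[OF fin subgroup_self carrier_finite_index ff' K']
    have sL: "subgroup L G" and fgL: "finitely_generated G L"
      using conjugate_subgroup conjugate_finitely_generated fgK g by auto
    have "K = carrier G"
    proof (rule ccontr)
      assume "K \<noteq> carrier G"
      then obtain a where a: "a \<in> carrier G" "\<forall>k>0. a [^] (k::nat) \<notin> K"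
        using factor_of_finite_index_avoids_powers[OF subgroup_self carrier_finite_index \<open>X \<noteq> {}\<close> ff' K']
        by blast
      have "\<not> finite_index G L"
      proof
        assume "finite_index G L"
        moreover have "g \<otimes> a \<otimes> inv g \<in> carrier G" using g(1) a(1) by simp
        ultimately obtain k :: nat where "k > 0" "(g \<otimes> a \<otimes> inv g) [^] k \<in> L"
          using finite_index_imp_power_mem[OF sL] by blast
        then show False using conjugate_power_mem[OF fgK(1) g(1) a(1)] a(2) g(2) by blast
      qed
      then show False using mf l c(3) sL fgL unfolding minimally_filling_def by blast
    qed
    then show ?thesis unfolding system_le_def using self c(1) K(2) by blast
  qed
  then show ?thesis unfolding filling_def is_free_factor_support_def using sys car by blast
qed

lemma (in free_group) minimally_filling_no_proper_factor:
  assumes fin: "finite X" and "X \<noteq> {}" and mf: "minimally_filling G X S"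
    and H: "subgroup H G" "finite_index G H"
    and A: "proper_free_factor (G\<lparr>carrier := H\<rparr>) A" and l: "l \<in> S"
  shows "\<not> carries G X A l"
proof -
  obtain B where ff: "free_factorization (G\<lparr>carrier := H\<rparr>) [A, B]" and ne: "A \<noteq> H"
    using A unfolding proper_free_factor_def by auto
  have sub: "subgroup A G" "finitely_generated G A"
    using factor_of_finite_index_finitely_generated[OF fin H ff] by auto
  obtain c where "c \<in> carrier G" "\<forall>k>0. c [^] (k::nat) \<notin> A"
    using factor_of_finite_index_avoids_powers[OF H \<open>X \<noteq> {}\<close> ff _ ne] by auto
  then have "\<not> finite_index G A" using finite_index_imp_power_mem[OF sub(1)] by blast
  then show ?thesis using mf sub l unfolding minimally_filling_def by blast
qed

lemma (in free_group) no_proper_factor_minimally_filling: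
  assumes "\<And>H A l. subgroup H G \<Longrightarrow> finite_index G H \<Longrightarrow>
    proper_free_factor (G\<lparr>carrier := H\<rparr>) A \<Longrightarrow> l \<in> S \<Longrightarrow> \<not> carries G X A l"
  shows "minimally_filling G X S"
  unfolding minimally_filling_def
proof
  assume "\<exists>K. subgroup K G \<and> finitely_generated G K \<and> \<not> finite_index G K \<and> (\<exists>l\<in>S. carries G X K l)"
  then obtain K l where K: "subgroup K G" "finitely_generated G K" "\<not> finite_index G K"
    and l: "l \<in> S" "carries G X K l" by blast
  obtain H B where H: "subgroup H G" "finite_index G H"
    and ff: "free_factorization (G\<lparr>carrier := H\<rparr>) [K, B]"
    using marshall_hall[OF K(1,2)] by blast
  have "K \<noteq> H" using K(3) H(2) by blast
  then have "proper_free_factor (G\<lparr>carrier := H\<rparr>) K"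
    unfolding proper_free_factor_def using ff by auto
  then show False using assms H l by blast
qed

theorem proposition4p10:
  fixes F :: "('a, 'm) monoid_scheme"
    and X :: "'a set"
    and S :: "(nat \<Rightarrow> 'a letter) set set set"
  assumes "group F"
    and "free_basis F X" and "finite X" and "card X \<ge> 3"
    and "S \<subseteq> lines F X"
  shows "(filling F X S \<and>
           \<not> (\<exists>H A. subgroup H F \<and> finite_index F H \<and>
                    proper_free_factor (F\<lparr>carrier := H\<rparr>) A \<and> (\<exists>l \<in> S. carries F X A l))
          \<longrightarrow> minimally_filling F X S) \<and>
         (S \<noteq> {} \<longrightarrow> minimally_filling F X S \<longrightarrow>
           filling F X S \<and>
           \<not> (\<exists>H A. subgroup H F \<and> finite_index F H \<and>
                    proper_free_factor (F\<lparr>carrier := H\<rparr>) A \<and> (\<exists>l \<in> S. carries F X A l)))"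
proof -
  interpret free_group F X
    using assms(1,2) by (intro free_group.intro free_group_axioms.intro)
  have X: "X \<noteq> {}" using assms(4) by auto
  show ?thesis
  proof (intro conjI impI)
    assume "filling F X S \<and> \<not> (\<exists>H A. subgroup H F \<and> finite_index F H \<and>
      proper_free_factor (F\<lparr>carrier := H\<rparr>) A \<and> (\<exists>l \<in> S. carries F X A l))"
    then show "minimally_filling F X S"
      by (intro no_proper_factor_minimally_filling) blast
  next
    assume "S \<noteq> {}" "minimally_filling F X S"
    then show "filling F X S" using minimally_filling_filling[OF assms(3) X assms(5)] by blast
  next
    assume "minimally_filling F X S"
    then show "\<not> (\<exists>H A. subgroup H F \<and> finite_index F H \<and>
      proper_free_factor (F\<lparr>carrier := H\<rparr>) A \<and> (\<exists>l \<in> S. carries F X A l))"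
      using minimally_filling_no_proper_factor[OF assms(3) X] by blast
  qed
qed

end
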